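(* Let $n$ be a nonzero integer. The Baumslag-Solitar group $\mathrm{BS}(1, n)$ has periodic asymptotic dimension $2$ or $3$, i.e. $\mathrm{pdim}(\mathrm{BS}(1,n)) \in \{2, 3\}$.
   Context: $\mathrm{BS}(1,n) = \langle a, t \mid t a t^{-1} = a^n \rangle$; equivalently it is the semidirect product $\mathbb{Z}[\frac1n] \rtimes \mathbb{Z}$ with the generator of $\mathbb{Z}$ acting by multiplication by $n$. Periodic asymptotic dimension: let $G$ be a finitely generated group with a fixed finite symmetric generating set and word norm $|\cdot|$. $G$ acts on $\{1,\ldots,k\}^G$ by $(gx)_h = x_{g^{-1}h}$, and a configuration $x$ is periodic if its stabilizer has finite index in $G$. For $k, r, m \in \mathbb{N}$ let $X_{k,r,m} \subset \{1,\ldots,k\}^G$ be the set of $x$ such that for each color $c \in \{1,\ldots,k\}$, the graph with vertex set $\{a \in G : x_a = c\}$ and edges $\{(a,b) : x_a = x_b = c,\ |a^{-1}b| \leq r\}$ has all connected components of cardinality at most $m$. The periodic asymptotic dimension $\mathrm{pdim}(G)$ is the infimum of all $d \in \mathbb{N} = \{0,1,2,\ldots\}$ such that for all $r$ there exists $m$ such that $X_{d+1,r,m}$ contains a periodic point (it is $\infty$ if no such $d$ exists). It does not depend on the choice of finite generating set. *)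

theory Defs
  imports
    "HOL-Algebra.Generated_Groups"
    "HOL-Algebra.Group_Action"
    "HOL-Library.Extended_Nat"
    "HOL-Library.FuncSet"
begin

section \<open>Groups given by generators and relations\<close>

text \<open>
  A word is a list of letters; the letter \<open>(x, True)\<close> stands for the generator \<open>x\<close> and
  \<open>(x, False)\<close> for its formal inverse. A relation \<open>(l, r)\<close> stands for the equation \<open>l = r\<close>.
\<close>

type_synonym 'g word = "('g \<times> bool) list"

inductive word_eq :: "('g word \<times> 'g word) set \<Rightarrow> 'g word \<Rightarrow> 'g word \<Rightarrow> bool"
  for R where
  refl: "word_eq R w w"
| sym: "word_eq R v w \<Longrightarrow> word_eq R w v"
| trans: "word_eq R u v \<Longrightarrow> word_eq R v w \<Longrightarrow> word_eq R u w"
| cancel: "word_eq R (u @ [(x, e), (x, \<not> e)] @ v) (u @ v)"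
| relation: "(l, r) \<in> R \<Longrightarrow> word_eq R (u @ l @ v) (u @ r @ v)"

definition word_eq_rel :: "('g word \<times> 'g word) set \<Rightarrow> ('g word \<times> 'g word) set" where
  "word_eq_rel R = {(u, v). word_eq R u v}"

definition presented_group :: "('g word \<times> 'g word) set \<Rightarrow> 'g word set monoid" where
  "presented_group R =
     \<lparr>carrier = UNIV // word_eq_rel R,
      mult = (\<lambda>A B. \<Union>u\<in>A. \<Union>v\<in>B. word_eq_rel R `` {u @ v}),
      one = word_eq_rel R `` {[]}\<rparr>"

lemma equiv_word_eq_rel: "equiv UNIV (word_eq_rel R)"
proof (rule equivI)
  show "refl (word_eq_rel R)"
    by (simp add: word_eq_rel_def refl_on_def word_eq.refl)
  show "sym (word_eq_rel R)"
    by (simp add: word_eq_rel_def sym_def word_eq.sym)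
  show "trans (word_eq_rel R)"
    unfolding word_eq_rel_def trans_def by (blast intro: word_eq.trans)
qed simp

lemma word_eq_append_left: "word_eq R u v \<Longrightarrow> word_eq R (w @ u) (w @ v)"
proof (induction rule: word_eq.induct)
  case (cancel u x e v)
  then show ?case using word_eq.cancel[of R "w @ u" x e v] by simp
next
  case (relation l r u v)
  then show ?case using word_eq.relation[of l r R "w @ u" v] by simp
next
  case (refl w')
  show ?case by (rule word_eq.refl)
next
  case (sym v w')
  show ?case by (rule word_eq.sym[OF sym.IH])
next
  case (trans u v w')
  show ?case by (rule word_eq.trans[OF trans.IH])
qed

lemma word_eq_append_right: "word_eq R u v \<Longrightarrow> word_eq R (u @ w) (v @ w)"
proof (induction rule: word_eq.induct)
  case (cancel u x e v)
  then show ?case using word_eq.cancel[of R u x e "v @ w"] by simp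
next
  case (relation l r u v)
  then show ?case using word_eq.relation[of l r R u "v @ w"] by simp
next
  case (refl w')
  show ?case by (rule word_eq.refl)
next
  case (sym v w')
  show ?case by (rule word_eq.sym[OF sym.IH])
next
  case (trans u v w')
  show ?case by (rule word_eq.trans[OF trans.IH])
qed

lemma word_eq_append:
  "word_eq R u u' \<Longrightarrow> word_eq R v v' \<Longrightarrow> word_eq R (u @ v) (u' @ v')"
  by (rule word_eq.trans[OF word_eq_append_right word_eq_append_left])

lemma presented_group_mult:
  "word_eq_rel R `` {u} \<otimes>\<^bsub>presented_group R\<^esub> word_eq_rel R `` {v} = word_eq_rel R `` {u @ v}"
proof -
  have "word_eq_rel R `` {u' @ v'} = word_eq_rel R `` {u @ v}"
    if "word_eq R u u'" "word_eq R v v'" for u' v'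
    using equiv_class_eq[OF equiv_word_eq_rel, of "u @ v" "u' @ v'" R] word_eq_append[OF that]
    by (simp add: word_eq_rel_def)
  then have eq: "word_eq_rel R `` {u' @ v'} = word_eq_rel R `` {u @ v}"
    if "u' \<in> word_eq_rel R `` {u}" "v' \<in> word_eq_rel R `` {v}" for u' v'
    using that by (simp add: word_eq_rel_def)
  have mem: "w \<in> word_eq_rel R `` {w}" for w
    by (simp add: word_eq_rel_def word_eq.refl)
  have "(\<Union>u'\<in>word_eq_rel R `` {u}. \<Union>v'\<in>word_eq_rel R `` {v}.
      word_eq_rel R `` {u' @ v'}) = (\<Union>u'\<in>word_eq_rel R `` {u}. word_eq_rel R `` {u @ v})"
    by (rule SUP_cong[OF HOL.refl]) (rule UN_constant_eq[OF mem], rule ballI, rule eq)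
  also have "\<dots> = word_eq_rel R `` {u @ v}"
    by (rule UN_constant_eq[OF mem]) (rule ballI, rule HOL.refl)
  finally show ?thesis
    by (simp add: presented_group_def)
qed

definition inverse_word :: "'g word \<Rightarrow> 'g word" where
  "inverse_word w = rev (map (\<lambda>(x, e). (x, \<not> e)) w)"

lemma word_eq_inverse_word: "word_eq R (inverse_word w @ w) []"
proof (induction w)
  case Nil
  show ?case by (simp add: inverse_word_def word_eq.refl)
next
  case (Cons y w)
  obtain x e where y: "y = (x, e)" by (cases y)
  have "word_eq R (inverse_word w @ [(x, \<not> e), (x, \<not> \<not> e)] @ w) (inverse_word w @ w)"
    by (rule word_eq.cancel)
  from word_eq.trans[OF this Cons.IH] show ?case by (simp add: inverse_word_def y)
qed

lemma group_presented_group: "group (presented_group R)"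
proof (rule groupI)
  let ?G = "presented_group R"
  let ?c = "\<lambda>u. word_eq_rel R `` {u}"
  have carrI: "?c u \<in> carrier ?G" for u
    by (simp add: presented_group_def quotientI)
  have carrE: thesis if "x \<in> carrier ?G" "\<And>u. x = ?c u \<Longrightarrow> thesis" for x thesis
    using that by (simp add: presented_group_def) (erule quotientE)
  have one: "\<one>\<^bsub>?G\<^esub> = ?c []" by (simp add: presented_group_def)
  show "x \<otimes>\<^bsub>?G\<^esub> y \<in> carrier ?G" if "x \<in> carrier ?G" "y \<in> carrier ?G" for x y
    using that by (elim carrE) (simp only: presented_group_mult carrI)
  show "\<one>\<^bsub>?G\<^esub> \<in> carrier ?G" by (simp only: one carrI)
  show "x \<otimes>\<^bsub>?G\<^esub> y \<otimes>\<^bsub>?G\<^esub> z = x \<otimes>\<^bsub>?G\<^esub> (y \<otimes>\<^bsub>?G\<^esub> z)"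
    if "x \<in> carrier ?G" "y \<in> carrier ?G" "z \<in> carrier ?G" for x y z
    using that by (elim carrE) (simp only: presented_group_mult append_assoc)
  show "\<one>\<^bsub>?G\<^esub> \<otimes>\<^bsub>?G\<^esub> x = x" if "x \<in> carrier ?G" for x
    using that by (elim carrE) (simp only: one presented_group_mult append_Nil)
  show "\<exists>y\<in>carrier ?G. y \<otimes>\<^bsub>?G\<^esub> x = \<one>\<^bsub>?G\<^esub>" if x: "x \<in> carrier ?G" for x
  proof -
    obtain u where u: "x = ?c u" using x by (rule carrE)
    have "(inverse_word u @ u, []) \<in> word_eq_rel R"
      by (simp add: word_eq_rel_def word_eq_inverse_word)
    then have "?c (inverse_word u) \<otimes>\<^bsub>?G\<^esub> x = \<one>\<^bsub>?G\<^esub>"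
      unfolding u one presented_group_mult by (rule equiv_class_eq[OF equiv_word_eq_rel])
    then show ?thesis using carrI by (rule bexI)
  qed
qed

section \<open>The Baumslag--Solitar groups $BS(1,n)$\<close>

datatype bs_gen = BS_a | BS_t

definition power_word :: "'g \<Rightarrow> int \<Rightarrow> 'g word" where
  "power_word x k = replicate (nat \<bar>k\<bar>) (x, 0 \<le> k)"

definition BS1 :: "int \<Rightarrow> bs_gen word set monoid" where
  "BS1 n = presented_group
     {([(BS_t, True), (BS_a, True), (BS_t, False)], power_word BS_a n)}"

section \<open>Periodic asymptotic dimension\<close>

definition finite_symmetric_generating_set :: "('a, 'b) monoid_scheme \<Rightarrow> 'a set \<Rightarrow> bool" where
  "finite_symmetric_generating_set G S \<longleftrightarrow>
     finite S \<and> S \<subseteq> carrier G \<and> (\<forall>s\<in>S. inv\<^bsub>G\<^esub> s \<in> S) \<and> generate G S = carrier G"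

definition word_norm :: "('a, 'b) monoid_scheme \<Rightarrow> 'a set \<Rightarrow> 'a \<Rightarrow> nat" where
  "word_norm G S g =
     (LEAST l. \<exists>ss. set ss \<subseteq> S \<and> length ss = l \<and> foldr (\<lambda>s h. s \<otimes>\<^bsub>G\<^esub> h) ss \<one>\<^bsub>G\<^esub> = g)"

text \<open>Configurations are extensional functions, so that equality means equality on \<open>carrier G\<close>.\<close>

definition configurations :: "('a, 'b) monoid_scheme \<Rightarrow> nat \<Rightarrow> ('a \<Rightarrow> nat) set" where
  "configurations G k = carrier G \<rightarrow>\<^sub>E {1..k}"

definition shift :: "('a, 'b) monoid_scheme \<Rightarrow> 'a \<Rightarrow> ('a \<Rightarrow> nat) \<Rightarrow> ('a \<Rightarrow> nat)" where
  "shift G g x = (\<lambda>h\<in>carrier G. x (inv\<^bsub>G\<^esub> g \<otimes>\<^bsub>G\<^esub> h))"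

definition periodic :: "('a, 'b) monoid_scheme \<Rightarrow> ('a \<Rightarrow> nat) \<Rightarrow> bool" where
  "periodic G x \<longleftrightarrow> finite (rcosets\<^bsub>G\<^esub> (stabilizer G (shift G) x))"

definition colour_class :: "('a, 'b) monoid_scheme \<Rightarrow> ('a \<Rightarrow> nat) \<Rightarrow> nat \<Rightarrow> 'a set" where
  "colour_class G x c = {a \<in> carrier G. x a = c}"

definition colour_edges ::
  "('a, 'b) monoid_scheme \<Rightarrow> 'a set \<Rightarrow> nat \<Rightarrow> ('a \<Rightarrow> nat) \<Rightarrow> nat \<Rightarrow> ('a \<times> 'a) set" where
  "colour_edges G S r x c =
     {(a, b). a \<in> colour_class G x c \<and> b \<in> colour_class G x c \<and>
        word_norm G S (inv\<^bsub>G\<^esub> a \<otimes>\<^bsub>G\<^esub> b) \<le> r}"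

text \<open>
  For a symmetric set \<open>S\<close> the edge relation is symmetric, so the connected component of a vertex \<open>a\<close> is the set of
  vertices reachable from \<open>a\<close>. Infinite sets have \<open>card\<close> equal to \<open>0\<close>, hence the explicit
  finiteness requirement.
\<close>

definition bounded_configurations ::
  "('a, 'b) monoid_scheme \<Rightarrow> 'a set \<Rightarrow> nat \<Rightarrow> nat \<Rightarrow> nat \<Rightarrow> ('a \<Rightarrow> nat) set" where
  "bounded_configurations G S k r m =
     {x \<in> configurations G k. \<forall>c\<in>{1..k}. \<forall>a\<in>colour_class G x c.
        finite ((colour_edges G S r x c)\<^sup>* `` {a}) \<and>
        card ((colour_edges G S r x c)\<^sup>* `` {a}) \<le> m}"

definition pdim :: "('a, 'b) monoid_scheme \<Rightarrow> 'a set \<Rightarrow> enat" where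
  "pdim G S =
     Inf {enat d | d. \<forall>r. \<exists>m. \<exists>x\<in>bounded_configurations G S (d + 1) r m. periodic G x}"

end

theory Submission
  imports Defs
begin

text \<open>
  The normal form \<open>t\<^sup>-\<^sup>p a\<^sup>i t\<^sup>q\<close> identifies \<open>BS(1,n)\<close> with the semidirect product of \<open>\<int>[1/n]\<close> and \<open>\<int>\<close>; let
  \<open>Q\<close> and \<open>T\<close> be the two coordinates.

  Two colours never suffice: a large rectangle in a sheet \<open>{t\<^sup>j a\<^sup>i}\<close>, which looks like a hyperbolic
  plane, is parametrised by a square grid so that neighbours in the grid are close in the group, and
  the Hex lemma yields a monochromatic path joining two opposite sides. Such a path visits many
  different group elements.

  Four colours suffice: cut the group into strips according to \<open>T\<close>, and alternate two pairs of colours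
  between the strips. Within a strip, after rescaling, \<open>Q\<close> moves by bounded integers; reduce it modulo a
  large \<open>N\<close> prime to \<open>n\<close> and colour the two halves of the circle \<open>\<int>/N\<close> differently. This is invariant
  under the finite-index subgroup of elements with \<open>Q\<close> divisible by \<open>N\<close> and \<open>T\<close> divisible by twice the
  height of a strip.
\<close>

subsection \<open>Normal forms in $BS(1,n)$\<close>

text \<open>Coordinates in the semidirect product of Z[1/n] and Z: a word with value
  \<open>(q, s)\<close> acts on the line by x -> n^s x + q, where \<open>a\<close> is the unit
  translation and \<open>t\<close> is multiplication by \<open>n\<close>.\<close>

fun bs_eval :: "int \<Rightarrow> bs_gen word \<Rightarrow> rat \<times> int" where
  "bs_eval n [] = (0, 0)"
| "bs_eval n ((BS_a, e) # w) = (fst (bs_eval n w) + (if e then 1 else - 1), snd (bs_eval n w))"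
| "bs_eval n ((BS_t, e) # w) =
     (of_int n powi (if e then 1 else - 1) * fst (bs_eval n w),
      snd (bs_eval n w) + (if e then 1 else - 1))"

lemma bs_eval_append:
  "n \<noteq> 0 \<Longrightarrow> bs_eval n (u @ v) =
    (fst (bs_eval n u) + of_int n powi snd (bs_eval n u) * fst (bs_eval n v),
     snd (bs_eval n u) + snd (bs_eval n v))"
proof (induction n u rule: bs_eval.induct)
  case (3 n e w)
  have "of_int n powi (snd (bs_eval n w) + (if e then 1 else - 1)) =
      of_int n powi (if e then 1 else - 1) * (of_int n powi snd (bs_eval n w) :: rat)"
    using 3 by (simp add: power_int_add)
  then show ?case using 3 by (simp add: distrib_left mult.assoc)
qed simp_all

lemma bs_eval_power_word_a: "bs_eval n (power_word BS_a k) = (of_int k, 0)"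
proof -
  have "bs_eval n (replicate m (BS_a, e)) = (of_nat m * (if e then 1 else - 1), 0)" for m e
    by (induction m) (auto simp: algebra_simps)
  then show ?thesis by (auto simp: power_word_def)
qed

lemma bs_eval_power_word_t: "bs_eval n (power_word BS_t k) = (0, k)"
proof -
  have "bs_eval n (replicate m (BS_t, e)) = (0, of_nat m * (if e then 1 else - 1))" for m e
    by (induction m) (auto simp: algebra_simps)
  then show ?thesis by (auto simp: power_word_def)
qed

abbreviation bs_rel :: "int \<Rightarrow> (bs_gen word \<times> bs_gen word) set" where
  "bs_rel n \<equiv> {([(BS_t, True), (BS_a, True), (BS_t, False)], power_word BS_a n)}"

text \<open>By \<open>bs_eval_append\<close> a rewriting in the middle of a word changes nothing as
  soon as the replaced piece keeps its value; \<open>t a t^-1\<close> and \<open>a^n\<close> both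
  have value \<open>(n, 0)\<close>.\<close>

lemma bs_eval_word_eq:
  assumes "word_eq (bs_rel n) u v" "n \<noteq> 0"
  shows "bs_eval n u = bs_eval n v"
  using assms
proof (induction rule: word_eq.induct)
  case (cancel u x e v)
  then have "bs_eval n ([(x, e), (x, \<not> e)] @ v) = bs_eval n v"
    by (cases x) (auto simp: power_int_minus field_simps prod_eq_iff)
  then show ?case by (simp only: bs_eval_append[OF assms(2), of u])
next
  case (relation l r u v)
  then have "bs_eval n l = bs_eval n r" by (auto simp: bs_eval_power_word_a)
  then show ?case by (simp only: bs_eval_append[OF assms(2)])
qed auto

section \<open>Group elements as classes of words\<close>

definition bs_class :: "int \<Rightarrow> bs_gen word \<Rightarrow> bs_gen word set" where
  "bs_class n w = word_eq_rel (bs_rel n) `` {w}"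

text \<open>An arbitrary representative is evaluated; for nonzero \<open>n\<close> the choice does
  not matter, by \<open>bs_eval_word_eq\<close>.\<close>

definition bs_val :: "int \<Rightarrow> bs_gen word set \<Rightarrow> rat \<times> int" where
  "bs_val n A = bs_eval n (SOME w. w \<in> A)"

lemma bs_val_class: "n \<noteq> 0 \<Longrightarrow> bs_val n (bs_class n w) = bs_eval n w"
proof -
  assume n: "n \<noteq> 0"
  have "w \<in> bs_class n w" by (simp add: bs_class_def word_eq_rel_def word_eq.refl)
  then have "(SOME w'. w' \<in> bs_class n w) \<in> bs_class n w" by (rule someI)
  then show ?thesis
    using bs_eval_word_eq[OF _ n] by (simp add: bs_val_def bs_class_def word_eq_rel_def)
qed

lemma group_BS1: "group (BS1 n)"
  by (simp add: BS1_def group_presented_group)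

lemma bs_class_closed: "bs_class n w \<in> carrier (BS1 n)"
  by (simp add: BS1_def presented_group_def bs_class_def quotientI)

lemma bs_class_cases:
  assumes "g \<in> carrier (BS1 n)" obtains w where "g = bs_class n w"
  using assms by (auto simp: BS1_def presented_group_def bs_class_def elim: quotientE)

lemma bs_class_append: "bs_class n (u @ v) = bs_class n u \<otimes>\<^bsub>BS1 n\<^esub> bs_class n v"
  by (simp add: BS1_def bs_class_def presented_group_mult)

lemma bs_class_Nil: "bs_class n [] = \<one>\<^bsub>BS1 n\<^esub>"
  by (simp add: BS1_def bs_class_def presented_group_def)

lemma bs_class_eqI: "word_eq (bs_rel n) u v \<Longrightarrow> bs_class n u = bs_class n v"
  unfolding bs_class_def
  by (rule equiv_class_eq[OF equiv_word_eq_rel]) (simp add: word_eq_rel_def)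

lemma bs_class_letter_inverse: "bs_class n [(x, False)] = inv\<^bsub>BS1 n\<^esub> bs_class n [(x, True)]"
proof -
  interpret group "BS1 n" by (rule group_BS1)
  have "bs_class n [(x, False)] \<otimes>\<^bsub>BS1 n\<^esub> bs_class n [(x, True)] = \<one>\<^bsub>BS1 n\<^esub>"
    using bs_class_eqI[OF word_eq.cancel[of "bs_rel n" "[]" x False "[]"]]
    by (simp flip: bs_class_append bs_class_Nil)
  then show ?thesis using bs_class_closed by (metis inv_equality)
qed

lemma bs_class_power_word:
  "bs_class n (power_word x k) = bs_class n [(x, True)] [^]\<^bsub>BS1 n\<^esub> k"
proof -
  interpret group "BS1 n" by (rule group_BS1)
  have *: "bs_class n (replicate m y) = bs_class n [y] [^]\<^bsub>BS1 n\<^esub> m" for m y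
  proof (induction m)
    case 0
    show ?case by (simp add: bs_class_Nil)
  next
    case (Suc m)
    have "bs_class n (replicate (Suc m) y) = bs_class n [y] \<otimes>\<^bsub>BS1 n\<^esub> bs_class n (replicate m y)"
      by (simp flip: bs_class_append)
    also have "\<dots> = bs_class n [y] [^]\<^bsub>BS1 n\<^esub> Suc m"
      unfolding Suc.IH by (rule nat_pow_Suc2[symmetric]) (rule bs_class_closed)
    finally show ?case .
  qed
  show ?thesis
  proof (cases "0 \<le> k")
    case True
    then have "power_word x k = replicate (nat k) (x, True)" by (simp add: power_word_def)
    moreover have "y [^]\<^bsub>BS1 n\<^esub> k = y [^]\<^bsub>BS1 n\<^esub> nat k" for y
      using True by (metis int_pow_int nat_0_le)
    ultimately show ?thesis by (simp only: *)
  next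
    case False
    then have "power_word x k = replicate (nat (- k)) (x, False)" by (simp add: power_word_def)
    moreover have "y [^]\<^bsub>BS1 n\<^esub> k = inv\<^bsub>BS1 n\<^esub> (y [^]\<^bsub>BS1 n\<^esub> nat (- k))" for y
      using False unfolding int_pow_def2 by simp
    ultimately show ?thesis
      by (simp only: * bs_class_letter_inverse nat_pow_inv[OF bs_class_closed])
  qed
qed

context group
begin

text \<open>Letters are multiplied on the left, which is why the normal form is \<open>t\<^sup>-\<^sup>p a\<^sup>i t\<^sup>q\<close>: moving
  \<open>a\<close> past \<open>t\<^sup>-\<^sup>p\<close> only needs \<open>a t\<^sup>-\<^sup>1 = t\<^sup>-\<^sup>1 a\<^sup>n\<close>, never an \<open>n\<close>-th root of \<open>a\<close>.\<close>

lemma bs_conj_pow: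
  assumes "a \<in> carrier G" "t \<in> carrier G" and rel: "t \<otimes> a \<otimes> inv t = a [^] (n::int)"
  shows "t \<otimes> a [^] (i::int) = a [^] (n * i) \<otimes> t"
proof -
  have hom: "group_hom G G (\<lambda>x. t \<otimes> x \<otimes> inv t)"
    using assms by unfold_locales (auto simp: hom_def m_assoc inv_solve_left)
  have "t \<otimes> a [^] i \<otimes> inv t = a [^] (n * i)"
    using group_hom.hom_int_pow[OF hom, of a i] assms by (simp add: int_pow_pow)
  then show ?thesis using assms by (metis inv_solve_right int_pow_closed m_closed)
qed

lemma bs_conj_pow_nat:
  assumes "a \<in> carrier G" "t \<in> carrier G" and rel: "t \<otimes> a \<otimes> inv t = a [^] (n::int)"
  shows "t [^] (p::nat) \<otimes> a [^] (i::int) = a [^] (n ^ p * i) \<otimes> t [^] p"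
proof (induction p arbitrary: i)
  case (Suc p)
  have "t [^] Suc p \<otimes> a [^] i = t [^] p \<otimes> (t \<otimes> a [^] i)" using assms by (simp add: m_assoc)
  also have "\<dots> = t [^] p \<otimes> a [^] (n * i) \<otimes> t"
    using assms bs_conj_pow[OF assms] by (simp add: m_assoc)
  also have "\<dots> = a [^] (n ^ p * (n * i)) \<otimes> t [^] p \<otimes> t" by (simp only: Suc.IH)
  finally show ?case using assms by (simp add: m_assoc mult_ac)
qed (use assms in simp)

end

text \<open>Induction on the word, one letter being put in front: a power of \<open>a\<close> passes
  \<open>t^-p\<close> by \<open>aux\<close>, \<open>t^-1\<close> raises \<open>p\<close>, and
  \<open>t\<close> cancels against \<open>t^-p\<close> or, if \<open>p\<close> is 0, passes
  \<open>a^i\<close> and raises \<open>q\<close>.\<close>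

lemma bs_normal_form:
  fixes n :: int
  defines "G \<equiv> BS1 n" and "a \<equiv> bs_class n [(BS_a, True)]" and "t \<equiv> bs_class n [(BS_t, True)]"
  shows "\<exists>p q i. bs_class n w = inv\<^bsub>G\<^esub> (t [^]\<^bsub>G\<^esub> (p::nat)) \<otimes>\<^bsub>G\<^esub> a [^]\<^bsub>G\<^esub> (i::int) \<otimes>\<^bsub>G\<^esub> t [^]\<^bsub>G\<^esub> (q::nat)"
proof -
  interpret group G unfolding G_def by (rule group_BS1)
  have a[simp]: "a \<in> carrier G" and t[simp]: "t \<in> carrier G"
    by (simp_all add: G_def a_def t_def bs_class_closed)
  have "bs_class n ([(BS_t, True)] @ [(BS_a, True)] @ [(BS_t, False)]) = bs_class n (power_word BS_a n)"
    using word_eq.relation[of _ _ "bs_rel n" "[]" "[]"] by (intro bs_class_eqI) simp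
  then have rel: "t \<otimes>\<^bsub>G\<^esub> a \<otimes>\<^bsub>G\<^esub> inv\<^bsub>G\<^esub> t = a [^]\<^bsub>G\<^esub> n"
    unfolding bs_class_append bs_class_power_word bs_class_letter_inverse
    by (simp add: bs_class_closed m_assoc flip: G_def a_def t_def)
  have aux: "a [^]\<^bsub>G\<^esub> k \<otimes>\<^bsub>G\<^esub> inv\<^bsub>G\<^esub> (t [^]\<^bsub>G\<^esub> p) = inv\<^bsub>G\<^esub> (t [^]\<^bsub>G\<^esub> p) \<otimes>\<^bsub>G\<^esub> a [^]\<^bsub>G\<^esub> (n ^ p * k)"
    for k :: int and p :: nat
  proof -
    have "t [^]\<^bsub>G\<^esub> p \<otimes>\<^bsub>G\<^esub> (a [^]\<^bsub>G\<^esub> k \<otimes>\<^bsub>G\<^esub> inv\<^bsub>G\<^esub> (t [^]\<^bsub>G\<^esub> p)) = (t [^]\<^bsub>G\<^esub> p \<otimes>\<^bsub>G\<^esub> a [^]\<^bsub>G\<^esub> k) \<otimes>\<^bsub>G\<^esub> inv\<^bsub>G\<^esub> (t [^]\<^bsub>G\<^esub> p)"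
      by (simp add: m_assoc)
    also have "\<dots> = a [^]\<^bsub>G\<^esub> (n ^ p * k) \<otimes>\<^bsub>G\<^esub> (t [^]\<^bsub>G\<^esub> p \<otimes>\<^bsub>G\<^esub> inv\<^bsub>G\<^esub> (t [^]\<^bsub>G\<^esub> p))"
      unfolding bs_conj_pow_nat[OF a t rel] by (intro m_assoc) simp_all
    finally have "a [^]\<^bsub>G\<^esub> (n ^ p * k) = t [^]\<^bsub>G\<^esub> p \<otimes>\<^bsub>G\<^esub> (a [^]\<^bsub>G\<^esub> k \<otimes>\<^bsub>G\<^esub> inv\<^bsub>G\<^esub> (t [^]\<^bsub>G\<^esub> p))"
      by simp
    then show ?thesis by (simp add: inv_solve_left)
  qed
  show ?thesis
  proof (induction w)
    case Nil
    have "bs_class n [] = inv\<^bsub>G\<^esub> (t [^]\<^bsub>G\<^esub> (0::nat)) \<otimes>\<^bsub>G\<^esub> a [^]\<^bsub>G\<^esub> (0::int) \<otimes>\<^bsub>G\<^esub> t [^]\<^bsub>G\<^esub> (0::nat)"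
      by (simp add: bs_class_Nil flip: G_def)
    then show ?case by blast
  next
    case (Cons y w)
    obtain x e where y: "y = (x, e)" by (cases y)
    obtain p q i where w: "bs_class n w =
        inv\<^bsub>G\<^esub> (t [^]\<^bsub>G\<^esub> (p::nat)) \<otimes>\<^bsub>G\<^esub> a [^]\<^bsub>G\<^esub> (i::int) \<otimes>\<^bsub>G\<^esub> t [^]\<^bsub>G\<^esub> (q::nat)"
      using Cons by blast
    have yw: "bs_class n (y # w) = bs_class n [y] \<otimes>\<^bsub>G\<^esub> bs_class n w"
      using bs_class_append[of n "[y]" w] by (simp add: G_def)
    show ?case
    proof (cases x)
      case BS_a
      define k :: int where "k = (if e then 1 else - 1)"
      have "bs_class n [y] = a [^]\<^bsub>G\<^esub> k"
        using bs_class_letter_inverse[of n BS_a]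
        by (auto simp: k_def y BS_a int_pow_neg a_def[symmetric] simp flip: G_def)
      then have "bs_class n (y # w) =
        (a [^]\<^bsub>G\<^esub> k \<otimes>\<^bsub>G\<^esub> inv\<^bsub>G\<^esub> (t [^]\<^bsub>G\<^esub> p)) \<otimes>\<^bsub>G\<^esub> a [^]\<^bsub>G\<^esub> i \<otimes>\<^bsub>G\<^esub> t [^]\<^bsub>G\<^esub> q"
        by (simp add: yw w m_assoc)
      also have "\<dots> = inv\<^bsub>G\<^esub> (t [^]\<^bsub>G\<^esub> p) \<otimes>\<^bsub>G\<^esub> a [^]\<^bsub>G\<^esub> (n ^ p * k + i) \<otimes>\<^bsub>G\<^esub> t [^]\<^bsub>G\<^esub> q"
        by (simp add: aux m_assoc int_pow_mult)
      finally show ?thesis by blast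
    next
      case BS_t
      show ?thesis
      proof (cases e)
        case False
        then have y': "bs_class n [y] = inv\<^bsub>G\<^esub> t"
          using bs_class_letter_inverse[of n BS_t] by (simp add: y BS_t t_def G_def)
        have "bs_class n (y # w) = inv\<^bsub>G\<^esub> (t [^]\<^bsub>G\<^esub> Suc p) \<otimes>\<^bsub>G\<^esub> a [^]\<^bsub>G\<^esub> i \<otimes>\<^bsub>G\<^esub> t [^]\<^bsub>G\<^esub> q"
          by (simp add: yw w y' m_assoc inv_mult_group)
        then show ?thesis by blast
      next
        case True
        then have y': "bs_class n [y] = t" by (simp add: y BS_t t_def)
        show ?thesis
        proof (cases p)
          case 0
          have "bs_class n (y # w) = (t \<otimes>\<^bsub>G\<^esub> a [^]\<^bsub>G\<^esub> i) \<otimes>\<^bsub>G\<^esub> t [^]\<^bsub>G\<^esub> q"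
            by (simp add: yw w y' 0 m_assoc)
          also have "\<dots> = inv\<^bsub>G\<^esub> (t [^]\<^bsub>G\<^esub> (0::nat)) \<otimes>\<^bsub>G\<^esub> a [^]\<^bsub>G\<^esub> (n * i) \<otimes>\<^bsub>G\<^esub> t [^]\<^bsub>G\<^esub> Suc q"
            using nat_pow_Suc2[OF t, of q]
            by (simp add: bs_conj_pow[OF a t rel] m_assoc del: nat_pow_Suc)
          finally show ?thesis by blast
        next
          case (Suc p')
          have cancel: "t \<otimes>\<^bsub>G\<^esub> (inv\<^bsub>G\<^esub> t \<otimes>\<^bsub>G\<^esub> z) = z" if "z \<in> carrier G" for z
            using that by (simp flip: m_assoc)
          have "bs_class n (y # w) = inv\<^bsub>G\<^esub> (t [^]\<^bsub>G\<^esub> p') \<otimes>\<^bsub>G\<^esub> a [^]\<^bsub>G\<^esub> i \<otimes>\<^bsub>G\<^esub> t [^]\<^bsub>G\<^esub> q"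
            by (simp add: yw w y' Suc m_assoc inv_mult_group cancel)
          then show ?thesis by blast
        qed
      qed
    qed
  qed
qed

text \<open>The interface to BS(1,n) for everything below: injective coordinates in the semidirect
  product, with \<open>Q\<close> in Z[1/n]. Surjectivity is asked for at the points
  \<open>t^j a^i\<close>, of which the sheet consists.\<close>

locale bs_model = group G for G (structure) +
  fixes n :: int and Q :: "'a \<Rightarrow> rat" and T :: "'a \<Rightarrow> int"
  assumes n_nonzero: "n \<noteq> 0"
    and Q_mult: "\<lbrakk>x \<in> carrier G; y \<in> carrier G\<rbrakk> \<Longrightarrow> Q (x \<otimes> y) = Q x + of_int n powi T x * Q y"
    and T_mult: "\<lbrakk>x \<in> carrier G; y \<in> carrier G\<rbrakk> \<Longrightarrow> T (x \<otimes> y) = T x + T y"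
    and QT_inj: "\<lbrakk>x \<in> carrier G; y \<in> carrier G; Q x = Q y; T x = T y\<rbrakk> \<Longrightarrow> x = y"
    and Q_denominator: "x \<in> carrier G \<Longrightarrow> \<exists>k. of_int n ^ k * Q x \<in> \<int>"
    and QT_surj: "\<exists>x\<in>carrier G. Q x = of_int n powi j * of_int i \<and> T x = j"

lemma bs_eval_denominator: "n \<noteq> 0 \<Longrightarrow> \<exists>k. of_int n ^ k * fst (bs_eval n w) \<in> \<int>"
proof (induction n w rule: bs_eval.induct)
  case (2 n e w)
  then obtain k where "of_int n ^ k * fst (bs_eval n w) \<in> \<int>" by blast
  then have "of_int n ^ k * fst (bs_eval n w) + of_int n ^ k * (if e then 1 else - 1) \<in> \<int>"
    by (intro Ints_add) auto
  then show ?case by (auto simp: distrib_left simp del: of_int_power)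
next
  case (3 n e w)
  then obtain k where k: "of_int n ^ k * fst (bs_eval n w) \<in> \<int>" by blast
  show ?case
  proof (cases e)
    case True
    have "of_int n * (of_int n ^ k * fst (bs_eval n w)) \<in> \<int>" by (rule Ints_mult[OF Ints_of_int k])
    moreover have "of_int n ^ k * fst (bs_eval n ((BS_t, e) # w)) = of_int n * (of_int n ^ k * fst (bs_eval n w))"
      using True by simp
    ultimately show ?thesis by metis
  next
    case False
    have "of_int n ^ Suc k * (inverse (of_int n) * fst (bs_eval n w)) = of_int n ^ k * fst (bs_eval n w)"
      using 3 by simp
    then have "of_int n ^ Suc k * fst (bs_eval n ((BS_t, e) # w)) = of_int n ^ k * fst (bs_eval n w)"
      using False by (simp add: power_int_minus)
    then show ?thesis using k by metis
  qed
qed (auto intro: exI[of _ 0])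

text \<open>Injectivity rests on the normal form: \<open>t^-p a^i t^q\<close> has value
  \<open>(n^-p i, q - p)\<close>, so a trivial value forces \<open>i = 0\<close> and
  \<open>q = p\<close>. This is applied to the quotient of two elements with equal
  coordinates.\<close>

lemma bs_model_BS1:
  assumes n: "n \<noteq> 0"
  shows "bs_model (BS1 n) n (fst \<circ> bs_val n) (snd \<circ> bs_val n)"
proof -
  interpret group "BS1 n" by (rule group_BS1)
  note [simp] = bs_val_class[OF n]
  have mult: "fst (bs_val n (x \<otimes>\<^bsub>BS1 n\<^esub> y)) = fst (bs_val n x) + of_int n powi snd (bs_val n x) * fst (bs_val n y)"
      "snd (bs_val n (x \<otimes>\<^bsub>BS1 n\<^esub> y)) = snd (bs_val n x) + snd (bs_val n y)"
    if "x \<in> carrier (BS1 n)" "y \<in> carrier (BS1 n)" for x y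
    using that by (auto elim!: bs_class_cases simp: bs_eval_append[OF n] simp flip: bs_class_append)
  have kernel: "h = \<one>\<^bsub>BS1 n\<^esub>" if h: "h \<in> carrier (BS1 n)" "bs_val n h = (0, 0)" for h
  proof -
    let ?t = "bs_class n [(BS_t, True)]" and ?a = "bs_class n [(BS_a, True)]"
    obtain w where w: "h = bs_class n w" using h by (blast elim: bs_class_cases)
    obtain p q i where nf: "h = inv\<^bsub>BS1 n\<^esub> (?t [^]\<^bsub>BS1 n\<^esub> (p::nat)) \<otimes>\<^bsub>BS1 n\<^esub> ?a [^]\<^bsub>BS1 n\<^esub> (i::int)
        \<otimes>\<^bsub>BS1 n\<^esub> ?t [^]\<^bsub>BS1 n\<^esub> (q::nat)"
      using bs_normal_form[of n w] w by blast
    also have "inv\<^bsub>BS1 n\<^esub> (?t [^]\<^bsub>BS1 n\<^esub> p) = bs_class n (power_word BS_t (- int p))"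
      by (simp add: bs_class_power_word int_pow_neg int_pow_int bs_class_closed)
    also have "?t [^]\<^bsub>BS1 n\<^esub> q = bs_class n (power_word BS_t (int q))"
      by (simp add: bs_class_power_word int_pow_int)
    also have "?a [^]\<^bsub>BS1 n\<^esub> i = bs_class n (power_word BS_a i)"
      by (simp add: bs_class_power_word)
    finally have "bs_val n h = (of_int n powi (- int p) * of_int i, int q - int p)"
      by (simp add: bs_eval_append[OF n] bs_eval_power_word_t bs_eval_power_word_a
        flip: bs_class_append)
    then have "i = 0" "q = p" using h n by auto
    then show ?thesis unfolding nf by (simp add: bs_class_closed)
  qed
  show ?thesis
  proof unfold_locales
    fix x y
    assume xy: "x \<in> carrier (BS1 n)" "y \<in> carrier (BS1 n)"
      and "(fst \<circ> bs_val n) x = (fst \<circ> bs_val n) y" "(snd \<circ> bs_val n) x = (snd \<circ> bs_val n) y"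
    then have eq: "bs_val n x = bs_val n y" by (simp add: prod_eq_iff)
    have one: "bs_val n \<one>\<^bsub>BS1 n\<^esub> = (0, 0)" by (simp flip: bs_class_Nil)
    have "bs_val n (inv\<^bsub>BS1 n\<^esub> x \<otimes>\<^bsub>BS1 n\<^esub> y) = bs_val n (inv\<^bsub>BS1 n\<^esub> x \<otimes>\<^bsub>BS1 n\<^esub> x)"
      using mult[OF inv_closed[OF xy(1)]] xy eq by (simp only: prod_eq_iff)
    then have "inv\<^bsub>BS1 n\<^esub> x \<otimes>\<^bsub>BS1 n\<^esub> y = \<one>\<^bsub>BS1 n\<^esub>" using xy one by (intro kernel) auto
    then show "x = y" using xy by (metis inv_closed inv_equality inv_inv)
  next
    fix x assume "x \<in> carrier (BS1 n)"
    then show "\<exists>k. of_int n ^ k * (fst \<circ> bs_val n) x \<in> \<int>"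
      using bs_eval_denominator[OF n] by (auto elim!: bs_class_cases)
  next
    fix i j :: int
    have "bs_val n (bs_class n (power_word BS_t j @ power_word BS_a i)) = (of_int n powi j * of_int i, j)"
      by (simp add: bs_eval_append[OF n] bs_eval_power_word_t bs_eval_power_word_a)
    then show "\<exists>x\<in>carrier (BS1 n). (fst \<circ> bs_val n) x = of_int n powi j * of_int i \<and> (snd \<circ> bs_val n) x = j"
      using bs_class_closed by (metis comp_apply fst_conv snd_conv)
  qed (use n mult in auto)
qed

subsection \<open>Balls in the word norm\<close>

context group
begin

lemma foldr_mult_closed: "set ss \<subseteq> carrier G \<Longrightarrow> foldr (\<otimes>) ss \<one> \<in> carrier G"
  by (induction ss) auto

lemma foldr_mult_append:
  assumes "set ss \<subseteq> carrier G" "set ts \<subseteq> carrier G"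
  shows "foldr (\<otimes>) (ss @ ts) \<one> = foldr (\<otimes>) ss \<one> \<otimes> foldr (\<otimes>) ts \<one>"
  using assms(1) by (induction ss) (auto simp: m_assoc foldr_mult_closed[OF assms(2)] foldr_mult_closed)

text \<open>A \<open>LEAST\<close> is meaningful only once some word for \<open>g\<close> exists;
  generation provides one, the symmetry of \<open>S\<close> absorbing the inverses.\<close>

lemma word_norm_attained:
  assumes S: "finite_symmetric_generating_set G S" and g: "g \<in> carrier G"
  shows "\<exists>ss. set ss \<subseteq> S \<and> length ss = word_norm G S g \<and> foldr (\<otimes>) ss \<one> = g"
proof -
  have SG: "S \<subseteq> carrier G" and inv: "\<And>s. s \<in> S \<Longrightarrow> inv s \<in> S" and gen: "g \<in> generate G S"
    using S g by (auto simp: finite_symmetric_generating_set_def)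
  from gen have "\<exists>ss. set ss \<subseteq> S \<and> foldr (\<otimes>) ss \<one> = g"
  proof (induction rule: generate.induct)
    case one
    show ?case by (intro exI[of _ "[]"]) simp
  next
    case (incl h)
    then show ?case using SG by (intro exI[of _ "[h]"]) auto
  next
    case (inv h)
    then show ?case using SG \<open>\<And>s. s \<in> S \<Longrightarrow> inv s \<in> S\<close> by (intro exI[of _ "[inv h]"]) auto
  next
    case (eng h1 h2)
    then obtain ss ts where "set ss \<subseteq> S" "foldr (\<otimes>) ss \<one> = h1" "set ts \<subseteq> S" "foldr (\<otimes>) ts \<one> = h2"
      by blast
    then show ?case using foldr_mult_append[of ss ts] SG by (intro exI[of _ "ss @ ts"]) auto
  qed
  then have "\<exists>l ss. set ss \<subseteq> S \<and> length ss = l \<and> foldr (\<otimes>) ss \<one> = g" by blast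
  then show ?thesis unfolding word_norm_def by (rule LeastI_ex)
qed

lemma finite_word_norm_ball:
  assumes S: "finite_symmetric_generating_set G S"
  shows "finite {g \<in> carrier G. word_norm G S g \<le> r}"
proof (rule finite_subset)
  show "{g \<in> carrier G. word_norm G S g \<le> r} \<subseteq>
      (\<lambda>ss. foldr (\<otimes>) ss \<one>) ` {ss. set ss \<subseteq> S \<and> length ss \<le> r}"
    using word_norm_attained[OF S] by (force simp: image_iff)
  show "finite ((\<lambda>ss. foldr (\<otimes>) ss \<one>) ` {ss. set ss \<subseteq> S \<and> length ss \<le> r})"
    using S by (intro finite_imageI finite_lists_length_le)
      (simp add: finite_symmetric_generating_set_def)
qed

end

subsection \<open>The Hex lemma on a grid\<close>

text \<open>Sperner's lemma for the labels A, B and neither. Every triangle has an even number of A-B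
  edges, so the parity of the number of A-B edges in a row does not depend on the row.\<close>

lemma grid_sperner:
  fixes A B :: "nat \<Rightarrow> nat \<Rightarrow> bool"
  assumes disj: "\<And>i j. \<not> (A i j \<and> B i j)"
    and left: "\<And>j. A 0 j" and bottom: "\<And>i. 0 < i \<Longrightarrow> B i 0"
    and right: "\<And>j. j \<le> q \<Longrightarrow> \<not> A p j" and top: "\<And>i. i \<le> p \<Longrightarrow> \<not> B i q"
    and closed: "\<And>i j i' j' i'' j''. \<lbrakk>A i j; B i' j'; i \<le> p; i' \<le> p; i'' \<le> p; j \<le> q; j' \<le> q; j'' \<le> q;
        \<bar>int i - int i'\<bar> \<le> 1; \<bar>int j - int j'\<bar> \<le> 1; \<bar>int i - int i''\<bar> \<le> 1; \<bar>int j - int j''\<bar> \<le> 1;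
        \<bar>int i' - int i''\<bar> \<le> 1; \<bar>int j' - int j''\<bar> \<le> 1\<rbrakk> \<Longrightarrow> A i'' j'' \<or> B i'' j''"
  shows False
proof -
  \<comment> \<open>Indicator of an edge with one end labelled A and the other labelled B.\<close>
  define D :: "nat \<Rightarrow> nat \<Rightarrow> nat \<Rightarrow> nat \<Rightarrow> nat" where
    "D i j i' j' = (if A i j \<and> B i' j' \<or> B i j \<and> A i' j' then 1 else 0)" for i j i' j'
  have sq: "even (D i j (Suc i) j + D (Suc i) j (Suc i) (Suc j) + D i (Suc j) (Suc i) (Suc j)
      + D i j i (Suc j))" if "i < p" "j < q" for i j
  proof -
    \<comment> \<open>A diagonal cuts the square into two triangles; it occurs in both sums and
      drops out modulo 2.\<close>
    have t1: "even (D i j (Suc i) j + D (Suc i) j (Suc i) (Suc j) + D i j (Suc i) (Suc j))"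
      using closed[of i j "Suc i" j "Suc i" "Suc j"] closed[of i j "Suc i" "Suc j" "Suc i" j]
        closed[of "Suc i" j i j "Suc i" "Suc j"] closed[of "Suc i" j "Suc i" "Suc j" i j]
        closed[of "Suc i" "Suc j" i j "Suc i" j] closed[of "Suc i" "Suc j" "Suc i" j i j]
        disj[of i j] disj[of "Suc i" j] disj[of "Suc i" "Suc j"] that
      unfolding D_def by (auto simp del: of_nat_Suc)
    have t2: "even (D i (Suc j) (Suc i) (Suc j) + D i j i (Suc j) + D i j (Suc i) (Suc j))"
      using closed[of i j i "Suc j" "Suc i" "Suc j"] closed[of i j "Suc i" "Suc j" i "Suc j"]
        closed[of i "Suc j" i j "Suc i" "Suc j"] closed[of i "Suc j" "Suc i" "Suc j" i j]
        closed[of "Suc i" "Suc j" i j i "Suc j"] closed[of "Suc i" "Suc j" i "Suc j" i j]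
        disj[of i j] disj[of i "Suc j"] disj[of "Suc i" "Suc j"] that
      unfolding D_def by (auto simp del: of_nat_Suc)
    from t1 t2 show ?thesis by presburger
  qed
  define H where "H j p' = (\<Sum>i<p'. D i j (Suc i) j)" for j p'
  have strip: "even (H j p' + H (Suc j) p' + D 0 j 0 (Suc j) + D p' j p' (Suc j))"
    if "j < q" "p' \<le> p" for j p'
    using that(2)
  proof (induction p')
    case (Suc p')
    then show ?case using sq[of p' j] that(1) by (simp add: H_def) presburger
  qed (simp add: H_def)
  \<comment> \<open>The two vertical sides contribute nothing: the left one is all A, the right one
    has no A.\<close>
  have step: "even (H j p) \<longleftrightarrow> even (H (Suc j) p)" if "j < q" for j
  proof -
    have "D 0 j 0 (Suc j) = 0" using left disj unfolding D_def by metis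
    moreover have "D p j p (Suc j) = 0" using right[of j] right[of "Suc j"] that by (simp add: D_def)
    ultimately show ?thesis using strip[OF that order_refl] by simp
  qed
  have "even (H 0 p) \<longleftrightarrow> even (H j p)" if "j \<le> q" for j
    using that by (induction j) (auto simp: step)
  then have "even (H 0 p) \<longleftrightarrow> even (H q p)" by blast
  moreover have "H q p = 0"
    unfolding H_def by (intro sum.neutral) (auto simp: D_def top)
  moreover have "p > 0" using left right[of 0] by (cases p) auto
  \<comment> \<open>In the bottom row the only A-B edge is the one at the corner
    \<open>(0, 0)\<close>, whereas the top row has none.\<close>
  then have "H 0 p = 1"
  proof -
    have "H 0 p = (\<Sum>i<p. if i = 0 then 1 else 0)"
      unfolding H_def using left bottom disj by (intro sum.cong) (auto simp: D_def)
    also have "\<dots> = 1" using \<open>p > 0\<close> by simp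
    finally show ?thesis .
  qed
  ultimately show False by simp
qed

definition grid_step :: "nat \<Rightarrow> nat \<Rightarrow> (nat \<Rightarrow> nat \<Rightarrow> bool) \<Rightarrow> ((nat \<times> nat) \<times> (nat \<times> nat)) set" where
  "grid_step p q P = {((i, j), (i', j')). i \<in> {1..p} \<and> i' \<in> {1..p} \<and> j \<in> {1..q} \<and> j' \<in> {1..q} \<and>
     P i j \<and> P i' j' \<and> \<bar>int i - int i'\<bar> \<le> 1 \<and> \<bar>int j - int j'\<bar> \<le> 1}"

text \<open>If there is no crossing, label A what \<open>P\<close> reaches from the left side and B
  what its complement reaches from the bottom side. A common neighbour of an A point and a B point
  satisfies \<open>P\<close> or not, so it is reached from one of them, and
  \<open>grid_sperner\<close> gives a contradiction.\<close>

lemma grid_hex: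
  assumes "0 < p" "0 < q"
  shows "(\<exists>j j'. j \<in> {1..q} \<and> P 1 j \<and> ((1, j), (p, j')) \<in> (grid_step p q P)\<^sup>*) \<or>
    (\<exists>i i'. i \<in> {1..p} \<and> \<not> P i 1 \<and> ((i, 1), (i', q)) \<in> (grid_step p q (\<lambda>i j. \<not> P i j))\<^sup>*)"
proof (rule ccontr)
  assume neg: "\<not> ?thesis"
  let ?N = "\<lambda>i j. \<not> P i j"
  \<comment> \<open>Column 0 and row 0 are an artificial border carrying the boundary labels; the
    condition \<open>i \<noteq> 0\<close> in \<open>B\<close> leaves the corner to
    \<open>A\<close>.\<close>
  define A where "A i j \<longleftrightarrow> i = 0 \<or> i \<in> {1..p} \<and> j \<in> {1..q} \<and> P i j \<and>
    (\<exists>j0 \<in> {1..q}. P 1 j0 \<and> ((1, j0), (i, j)) \<in> (grid_step p q P)\<^sup>*)" for i j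
  define B where "B i j \<longleftrightarrow> i \<noteq> 0 \<and> (j = 0 \<or> i \<in> {1..p} \<and> j \<in> {1..q} \<and> ?N i j \<and>
    (\<exists>i0 \<in> {1..p}. ?N i0 1 \<and> ((i0, 1), (i, j)) \<in> (grid_step p q ?N)\<^sup>*))" for i j
  show False
  proof (rule grid_sperner[of A B q p])
    show "\<not> (A i j \<and> B i j)" for i j unfolding A_def B_def by auto
    show "A 0 j" for j by (simp add: A_def)
    show "B i 0" if "0 < i" for i using that by (simp add: B_def)
    show "\<not> A p j" for j using neg assms by (auto simp: A_def)
    show "\<not> B i q" for i using neg assms by (auto simp: B_def)
    fix i j i' j' i'' j''
    assume A: "A i j" and B: "B i' j'" and le: "i \<le> p" "i' \<le> p" "i'' \<le> p" "j \<le> q" "j' \<le> q" "j'' \<le> q"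
      and d: "\<bar>int i - int i''\<bar> \<le> 1" "\<bar>int j - int j''\<bar> \<le> 1"
        "\<bar>int i' - int i''\<bar> \<le> 1" "\<bar>int j' - int j''\<bar> \<le> 1"
    show "A i'' j'' \<or> B i'' j''"
    proof (cases "i'' = 0 \<or> j'' = 0")
      case True
      then show ?thesis by (auto simp: A_def B_def)
    next
      case False
      show ?thesis
      proof (cases "P i'' j''")
        case True
        have "A i'' j''"
        proof (cases "i = 0")
          case i: True
          then have "i'' = 1" using d False by linarith
          then show ?thesis using True False le unfolding A_def by (auto intro!: bexI[of _ j''])
        next
          case i: False
          then have "((i, j), (i'', j'')) \<in> grid_step p q P"
            using A True False le d by (auto simp: A_def grid_step_def)
          then show ?thesis
            using A True False le i unfolding A_def by (auto intro: rtrancl_into_rtrancl)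
        qed
        then show ?thesis ..
      next
        case nP: False
        have "B i'' j''"
        proof (cases "j' = 0")
          case j: True
          then have "j'' = 1" using d False by linarith
          then show ?thesis using nP False le unfolding B_def by (auto intro!: bexI[of _ i''])
        next
          case j: False
          then have "((i', j'), (i'', j'')) \<in> grid_step p q ?N"
            using B nP False le d by (auto simp: B_def grid_step_def)
          then show ?thesis
            using B nP False le j unfolding B_def by (auto intro: rtrancl_into_rtrancl)
        qed
        then show ?thesis ..
      qed
    qed
  qed
qed

text \<open>A step changes the column by at most one, so a path cannot jump over column
  \<open>k\<close>.\<close>

lemma grid_path_meets_column:
  assumes "((i0, j0), (i, j)) \<in> (grid_step p q P)\<^sup>*" "i0 \<le> k" "k \<le> i"
  shows "\<exists>j'. ((i0, j0), (k, j')) \<in> (grid_step p q P)\<^sup>*"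
  using assms
proof (induction "(i, j)" arbitrary: i j rule: rtrancl_induct)
  case base
  then have "k = i0" by simp
  then show ?case by blast
next
  case (step y)
  obtain i1 j1 where y: "y = (i1, j1)" by (cases y)
  show ?case
  proof (cases "k \<le> i1")
    case True
    then show ?thesis using step y by blast
  next
    case False
    then have "k = i" using step.hyps(2) step.prems y by (auto simp: grid_step_def)
    then show ?thesis using step.hyps by (meson rtrancl_into_rtrancl)
  qed
qed

lemma grid_path_meets_row:
  assumes "((i0, j0), (i, j)) \<in> (grid_step p q P)\<^sup>*" "j0 \<le> k" "k \<le> j"
  shows "\<exists>i'. ((i0, j0), (i', k)) \<in> (grid_step p q P)\<^sup>*"
  using assms
proof (induction "(i, j)" arbitrary: i j rule: rtrancl_induct)
  case base
  then have "k = j0" by simp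
  then show ?case by blast
next
  case (step y)
  obtain i1 j1 where y: "y = (i1, j1)" by (cases y)
  show ?case
  proof (cases "k \<le> j1")
    case True
    then show ?thesis using step y by blast
  next
    case False
    then have "k = j" using step.hyps(2) step.prems y by (auto simp: grid_step_def)
    then show ?thesis using step.hyps by (meson rtrancl_into_rtrancl)
  qed
qed

lemma grid_path_in_grid:
  assumes "(z, z') \<in> (grid_step p q P)\<^sup>*" "fst z \<in> {1..p}" "snd z \<in> {1..q}"
  shows "fst z' \<in> {1..p} \<and> snd z' \<in> {1..q}"
  using assms by (induction rule: rtrancl_induct) (auto simp: grid_step_def)

subsection \<open>Two colours do not suffice\<close>

context bs_model
begin

abbreviation nr :: rat where "nr \<equiv> of_int n"

declare n_nonzero [simp]

lemma abs_n_ge_1 [simp]: "1 \<le> \<bar>n\<bar>"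
  using n_nonzero by linarith

lemma powi_mult_powi: "nr powi i * nr powi j = nr powi (i + j)"
  by (simp add: power_int_add)

lemma QT_one [simp]: "Q \<one> = 0" "T \<one> = 0"
  using Q_mult[of \<one> \<one>] T_mult[of \<one> \<one>] by simp_all

lemma T_inv: "x \<in> carrier G \<Longrightarrow> T (inv x) = - T x"
  using T_mult[of x "inv x"] by simp

lemma Q_inv: "x \<in> carrier G \<Longrightarrow> Q (inv x) = - (nr powi - T x * Q x)"
  using Q_mult[of "inv x" x] by (simp add: T_inv eq_neg_iff_add_eq_0)

lemma Q_inv_mult:
  "\<lbrakk>x \<in> carrier G; y \<in> carrier G\<rbrakk> \<Longrightarrow> Q (inv x \<otimes> y) = nr powi - T x * (Q y - Q x)"
  by (simp add: Q_mult Q_inv T_inv right_diff_distrib)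

lemma T_inv_mult: "\<lbrakk>x \<in> carrier G; y \<in> carrier G\<rbrakk> \<Longrightarrow> T (inv x \<otimes> y) = T y - T x"
  by (simp add: T_mult T_inv)

text \<open>Row \<open>j\<close> of the grid is sent to the points \<open>t\<^sup>j a\<^sup>i\<close>, slowed down by the factor \<open>\<bar>n\<bar>\<^sup>j\<close>, so that
  vertically adjacent grid points remain close in the group.\<close>

definition sheet :: "nat \<Rightarrow> nat \<Rightarrow> 'a" where
  "sheet u j = (SOME g. g \<in> carrier G \<and>
     Q g = of_int (\<bar>n\<bar> ^ j * (int u div \<bar>n\<bar> ^ j)) \<and> T g = int j)"

lemma sheet:
  "sheet u j \<in> carrier G" "Q (sheet u j) = of_int (\<bar>n\<bar> ^ j * (int u div \<bar>n\<bar> ^ j))" "T (sheet u j) = int j"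
proof -
  have "(of_int (\<bar>n\<bar> ^ j * (int u div \<bar>n\<bar> ^ j)) :: rat) =
      nr powi int j * of_int (sgn n ^ j * (int u div \<bar>n\<bar> ^ j))"
  proof -
    \<comment> \<open>For negative \<open>n\<close> the sign is moved into the exponent of
      \<open>a\<close>, so that \<open>QT_surj\<close> applies.\<close>
    have "\<bar>n\<bar> ^ j = n ^ j * sgn n ^ j" by (simp add: abs_sgn flip: power_mult_distrib)
    then have "\<bar>n\<bar> ^ j * (int u div \<bar>n\<bar> ^ j) = n ^ j * (sgn n ^ j * (int u div \<bar>n\<bar> ^ j))"
      by (simp only: mult.assoc)
    then show ?thesis by (simp only: of_int_mult of_int_power power_int_of_nat)
  qed
  then have "\<exists>g. g \<in> carrier G \<and> Q g = of_int (\<bar>n\<bar> ^ j * (int u div \<bar>n\<bar> ^ j)) \<and> T g = int j"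
    using QT_surj[of "int j"] by (metis (no_types, lifting))
  from someI_ex[OF this]
  show "sheet u j \<in> carrier G" "Q (sheet u j) = of_int (\<bar>n\<bar> ^ j * (int u div \<bar>n\<bar> ^ j))" "T (sheet u j) = int j"
    unfolding sheet_def by blast+
qed

text \<open>Points of row \<open>j\<close> coincide only if their columns lie in the same block of
  length \<open>\<bar>n\<bar> ^ j\<close>. Passing to the coarser blocks of length
  \<open>\<bar>n\<bar> ^ k\<close> gives one test of distinctness for all rows up to
  \<open>k\<close>.\<close>

lemma sheet_eqD:
  assumes "sheet u j = sheet u' j'" "j \<le> k"
  shows "j = j'" "int u div \<bar>n\<bar> ^ k = int u' div \<bar>n\<bar> ^ k"
proof -
  show j: "j = j'" using sheet(3)[of u j] sheet(3)[of u' j'] assms by simp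
  have "\<bar>n\<bar> ^ j * (int u div \<bar>n\<bar> ^ j) = \<bar>n\<bar> ^ j * (int u' div \<bar>n\<bar> ^ j)"
    using sheet(2)[of u j] sheet(2)[of u' j] assms unfolding j by (simp only: of_int_eq_iff)
  then have *: "int u div \<bar>n\<bar> ^ j = int u' div \<bar>n\<bar> ^ j" using n_nonzero by simp
  have "v div \<bar>n\<bar> ^ k = v div \<bar>n\<bar> ^ j div \<bar>n\<bar> ^ (k - j)" for v :: int
    using assms(2) by (simp flip: zdiv_zmult2_eq power_add)
  then show "int u div \<bar>n\<bar> ^ k = int u' div \<bar>n\<bar> ^ k" using * by simp
qed

text \<open>A finite set, independent of the size of the grid, that contains the quotients of
  adjacent sheet points; its bounds are those obtained in \<open>sheet_adjacent\<close>.\<close>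

definition near_identity :: "'a set" where
  "near_identity = {g \<in> carrier G. \<bar>T g\<bar> \<le> 1 \<and> nr * Q g \<in> \<int> \<and> \<bar>Q g\<bar> \<le> 3 * of_int \<bar>n\<bar>}"

text \<open>The integers \<open>n Q\<close> and \<open>T\<close> determine the element and are
  bounded by \<open>3 n^2\<close> and 1.\<close>

lemma finite_near_identity: "finite near_identity"
proof (rule finite_imageD)
  let ?f = "\<lambda>g. (\<lfloor>nr * Q g\<rfloor>, T g)"
  show "inj_on ?f near_identity"
  proof (rule inj_onI)
    fix g h assume gh: "g \<in> near_identity" "h \<in> near_identity" "?f g = ?f h"
    then obtain y z where "nr * Q g = of_int y" "nr * Q h = of_int z"
      unfolding near_identity_def by (auto simp: Ints_def)
    then have "nr * Q g = nr * Q h" using gh(3) by simp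
    then have "Q g = Q h" by (simp add: n_nonzero)
    then show "g = h" using gh by (auto simp: near_identity_def dest: QT_inj)
  qed
  have "?f ` near_identity \<subseteq> {- 3 * n\<^sup>2..3 * n\<^sup>2} \<times> {- 1..1}"
  proof (rule image_subsetI)
    fix g assume g: "g \<in> near_identity"
    then obtain z where z: "nr * Q g = of_int z" by (auto simp: near_identity_def Ints_def)
    have "\<bar>nr\<bar> * \<bar>Q g\<bar> \<le> \<bar>nr\<bar> * (3 * \<bar>nr\<bar>)"
      using g by (intro mult_left_mono) (auto simp: near_identity_def)
    then have "of_int \<bar>z\<bar> \<le> (of_int (3 * n\<^sup>2) :: rat)"
      using z by (simp add: power2_eq_square flip: abs_mult)
    then have "\<bar>z\<bar> \<le> 3 * n\<^sup>2" by (simp only: of_int_le_iff)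
    then show "?f g \<in> {- 3 * n\<^sup>2..3 * n\<^sup>2} \<times> {- 1..1}" using z g by (auto simp: near_identity_def)
  qed
  then show "finite (?f ` near_identity)" by (rule finite_subset) simp
qed

text \<open>The \<open>Q\<close>-values \<open>z\<close> and \<open>z'\<close> round the columns
  down to multiples of \<open>\<bar>n\<bar> ^ j\<close> and \<open>\<bar>n\<bar> ^ j'\<close>. One
  factor \<open>n\<close> makes up for a row below \<open>j\<close>, which gives integrality. The
  two rounding errors and the step in \<open>u\<close> are each at most
  \<open>\<bar>n\<bar> ^ Suc j\<close>; division by \<open>\<bar>n\<bar> ^ j\<close> leaves
  \<open>3 \<bar>n\<bar>\<close>.\<close>

lemma sheet_adjacent:
  assumes u: "\<bar>int u - int u'\<bar> \<le> 1" and j: "\<bar>int j - int j'\<bar> \<le> 1"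
  shows "inv (sheet u j) \<otimes> sheet u' j' \<in> near_identity"
proof -
  let ?m = "\<bar>n\<bar>"
  define z where "z = ?m ^ j * (int u div ?m ^ j)"
  define z' where "z' = ?m ^ j' * (int u' div ?m ^ j')"
  have m: "?m \<ge> 1" using n_nonzero by simp
  have mpos: "0 < ?m ^ i" for i using n_nonzero by simp
  have QT: "Q (inv (sheet u j) \<otimes> sheet u' j') = nr powi - int j * of_int (z' - z)"
      "T (inv (sheet u j) \<otimes> sheet u' j') = int j' - int j"
    by (simp_all add: Q_inv_mult T_inv_mult sheet z_def z'_def)
  have "?m ^ j dvd ?m * z'"
  proof -
    have "?m ^ j dvd ?m ^ Suc j'" using j by (intro le_imp_power_dvd) linarith
    then show ?thesis by (simp add: z'_def mult.assoc[symmetric])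
  qed
  moreover have "?m ^ j dvd ?m * z" by (simp add: z_def)
  ultimately have "?m ^ j dvd ?m * (z' - z)" by (simp add: right_diff_distrib)
  moreover have "?m * (z' - z) dvd n * (z' - z)" "n ^ j dvd ?m ^ j"
    by (auto intro: mult_dvd_mono simp flip: power_abs)
  ultimately have "n ^ j dvd n * (z' - z)" by (meson dvd_trans)
  then obtain w where w: "n * (z' - z) = n ^ j * w" by blast
  have "nr * (nr powi - int j * of_int (z' - z)) = nr powi - int j * of_int (n * (z' - z))" by simp
  also have "\<dots> = of_int w" unfolding w using n_nonzero by (simp add: power_int_minus)
  finally have int: "nr * (nr powi - int j * of_int (z' - z)) \<in> \<int>" by simp
  have zu: "\<bar>z - int u\<bar> \<le> ?m ^ j"
  proof -
    have "int u = z + int u mod ?m ^ j" by (simp add: z_def)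
    moreover have "0 \<le> int u mod ?m ^ j" "int u mod ?m ^ j < ?m ^ j"
      by (rule pos_mod_sign[OF mpos] pos_mod_bound[OF mpos])+
    ultimately show ?thesis by linarith
  qed
  have zu': "\<bar>z' - int u'\<bar> \<le> ?m ^ j'"
  proof -
    have "int u' = z' + int u' mod ?m ^ j'" by (simp add: z'_def)
    moreover have "0 \<le> int u' mod ?m ^ j'" "int u' mod ?m ^ j' < ?m ^ j'"
      by (rule pos_mod_sign[OF mpos] pos_mod_bound[OF mpos])+
    ultimately show ?thesis by linarith
  qed
  have "?m ^ j \<le> ?m ^ Suc j" "?m ^ j' \<le> ?m ^ Suc j" "1 \<le> ?m ^ Suc j"
    using m j by (intro power_increasing one_le_power; linarith)+
  then have "\<bar>z' - z\<bar> \<le> 3 * ?m ^ Suc j" using zu zu' u by linarith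
  then have "\<bar>z' - z\<bar> \<le> 3 * ?m * ?m ^ j" by (simp add: mult.assoc)
  then have "(of_int \<bar>z' - z\<bar> :: rat) \<le> of_int (3 * ?m * ?m ^ j)" by (simp only: of_int_le_iff)
  then have "\<bar>nr powi - int j * of_int (z' - z)\<bar> \<le> 3 * of_int ?m"
    using m by (simp add: abs_mult power_int_minus power_abs divide_simps mult_ac)
  then show ?thesis using QT int j sheet(1) by (simp add: near_identity_def)
qed

lemma grid_path_sheet:
  assumes S: "finite_symmetric_generating_set G S"
    and r: "\<And>g. g \<in> near_identity \<Longrightarrow> word_norm G S g \<le> r"
    and P: "\<And>u j. P u j \<Longrightarrow> x (sheet u j) = c"
    and path: "((u, j), (u', j')) \<in> (grid_step p q P)\<^sup>*"
  shows "(sheet u j, sheet u' j') \<in> (colour_edges G S r x c)\<^sup>*"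
  using path
proof (induction "(u', j')" arbitrary: u' j' rule: rtrancl_induct)
  case (step y)
  obtain u1 j1 where y: "y = (u1, j1)" by (cases y)
  have "(sheet u1 j1, sheet u' j') \<in> colour_edges G S r x c"
    using step.hyps(2) unfolding y
    by (auto simp: grid_step_def colour_edges_def colour_class_def sheet P r sheet_adjacent)
  then show ?case using step.hyps(3)[OF y] by (rule rtrancl_into_rtrancl[rotated])
qed simp

text \<open>The scale \<open>r\<close> is the largest norm in \<open>near_identity\<close>, so for
  every \<open>m\<close> a monochromatic grid path lies in one component. The Hex lemma supplies a
  path with more than \<open>m\<close> distinct points.\<close>

lemma no_two_colouring:
  assumes S: "finite_symmetric_generating_set G S"
  shows "\<exists>r. \<forall>m. bounded_configurations G S 2 r m = {}"
proof -
  define r where "r = Max (word_norm G S ` near_identity)"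
  have r: "word_norm G S g \<le> r" if "g \<in> near_identity" for g
    using that finite_near_identity by (simp add: r_def)
  have False if x: "x \<in> bounded_configurations G S 2 r m" for x m
  proof -
    \<comment> \<open>\<open>k\<close> distinct points exceed the bound \<open>m\<close>; the width
      \<open>p\<close> makes room for \<open>k\<close> columns lying in different blocks of length
      \<open>\<bar>n\<bar> ^ k\<close>.\<close>
    define k where "k = Suc m"
    define p where "p = k * nat \<bar>n\<bar> ^ k"
    have pos: "0 < p" "0 < k" using n_nonzero by (simp_all add: p_def k_def)
    have bound: "card A \<le> m" "finite A"
      if "A \<subseteq> (colour_edges G S r x c)\<^sup>* `` {sheet u j}" "x (sheet u j) = c" for A c u j
    proof -
      have "x (sheet u j) \<in> {1..2}"
        using x sheet(1) by (auto simp: bounded_configurations_def configurations_def)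
      then have comp: "finite ((colour_edges G S r x c)\<^sup>* `` {sheet u j})"
          "card ((colour_edges G S r x c)\<^sup>* `` {sheet u j}) \<le> m"
        using x that(2) sheet(1)[of u j] by (auto simp: bounded_configurations_def colour_class_def)
      show "finite A" using that(1) comp(1) by (rule finite_subset)
      show "card A \<le> m" using card_mono[OF comp(1) that(1)] comp(2) by linarith
    qed
    have cols: "x (sheet u j) = 1 \<or> x (sheet u j) = 2" for u j
    proof -
      have "x (sheet u j) \<in> {1..2}"
        using x sheet(1) by (auto simp: bounded_configurations_def configurations_def)
      then show ?thesis by auto
    qed
    let ?P = "\<lambda>u j. x (sheet u j) = 1"
    from grid_hex[OF pos, of ?P] show False
    proof
      assume "\<exists>j j'. j \<in> {1..k} \<and> ?P 1 j \<and> ((1, j), (p, j')) \<in> (grid_step p k ?P)\<^sup>*"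
      then obtain j j' where j: "j \<in> {1..k}" "?P 1 j" and path: "((1, j), (p, j')) \<in> (grid_step p k ?P)\<^sup>*"
        by blast
      \<comment> \<open>A left-right crossing meets each column
        \<open>e * nat \<bar>n\<bar> ^ k\<close>; distinct \<open>e\<close> give distinct blocks,
        hence distinct points.\<close>
      have "\<exists>i. ((1, j), (e * nat \<bar>n\<bar> ^ k, i)) \<in> (grid_step p k ?P)\<^sup>*" if "e \<in> {1..k}" for e
        using grid_path_meets_column[OF path, of "e * nat \<bar>n\<bar> ^ k"] that n_nonzero
        by (simp add: p_def Suc_le_eq)
      then obtain f where f: "\<And>e. e \<in> {1..k} \<Longrightarrow>
          ((1, j), (e * nat \<bar>n\<bar> ^ k, f e)) \<in> (grid_step p k ?P)\<^sup>*"
        by metis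
      let ?g = "\<lambda>e. sheet (e * nat \<bar>n\<bar> ^ k) (f e)"
      have "inj_on ?g {1..k}"
      proof (rule inj_onI)
        fix e e' assume e: "e \<in> {1..k}" "e' \<in> {1..k}" and eq: "?g e = ?g e'"
        have "f e \<le> k" using grid_path_in_grid[OF f[OF e(1)]] j pos by auto
        from sheet_eqD(2)[OF eq this] show "e = e'" using n_nonzero by simp
      qed
      moreover have "?g ` {1..k} \<subseteq> (colour_edges G S r x 1)\<^sup>* `` {sheet 1 j}"
        using grid_path_sheet[OF S r _ f, of x 1] by auto
      from bound(1)[OF this j(2)] have "card (?g ` {1..k}) \<le> m" .
      ultimately show False by (simp add: card_image k_def)
    next
      assume "\<exists>i i'. i \<in> {1..p} \<and> \<not> ?P i 1 \<and> ((i, 1), (i', k)) \<in> (grid_step p k (\<lambda>i j. \<not> ?P i j))\<^sup>*"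
      then obtain i i' where i: "i \<in> {1..p}" "\<not> ?P i 1"
        and path: "((i, 1), (i', k)) \<in> (grid_step p k (\<lambda>i j. \<not> ?P i j))\<^sup>*"
        by blast
      \<comment> \<open>A bottom-top crossing meets every row, and points of different rows differ
        in \<open>T\<close>.\<close>
      have "\<exists>u. ((i, 1), (u, e)) \<in> (grid_step p k (\<lambda>i j. \<not> ?P i j))\<^sup>*" if "e \<in> {1..k}" for e
        using grid_path_meets_row[OF path, of e] that by simp
      then obtain f where f: "\<And>e. e \<in> {1..k} \<Longrightarrow>
          ((i, 1), (f e, e)) \<in> (grid_step p k (\<lambda>i j. \<not> ?P i j))\<^sup>*"
        by metis
      have col2: "\<not> ?P u j \<Longrightarrow> x (sheet u j) = 2" for u j using cols by blast
      have "inj_on (\<lambda>e. sheet (f e) e) {1..k}"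
        using sheet_eqD(1) by (intro inj_onI) blast
      moreover have "(\<lambda>e. sheet (f e) e) ` {1..k} \<subseteq> (colour_edges G S r x 2)\<^sup>* `` {sheet i 1}"
        using grid_path_sheet[where x = x and c = 2 and P = "\<lambda>u j. \<not> ?P u j", OF S r col2 f] by auto
      from bound(1)[OF this] i(2) cols have "card ((\<lambda>e. sheet (f e) e) ` {1..k}) \<le> m" by blast
      ultimately show False by (simp add: card_image k_def)
    qed
  qed
  then show ?thesis by blast
qed

end

text \<open>Additional colours have empty classes. This reduces the case of a single colour to that
  of two.\<close>

lemma bounded_configurations_mono_colours:
  assumes "k \<le> k'"
  shows "bounded_configurations G S k r m \<subseteq> bounded_configurations G S k' r m"
proof
  fix x assume x: "x \<in> bounded_configurations G S k r m"
  then have conf: "x \<in> configurations G k" by (simp add: bounded_configurations_def)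
  have "x \<in> configurations G k'"
    using conf assms unfolding configurations_def by (auto simp: PiE_iff extensional_def)
  moreover have "c \<in> {1..k}" if "a \<in> colour_class G x c" for a c
    using conf that unfolding configurations_def colour_class_def by auto
  ultimately show "x \<in> bounded_configurations G S k' r m"
    using x unfolding bounded_configurations_def by blast
qed

subsection \<open>A periodic colouring with four colours\<close>

text \<open>For nonzero \<open>n\<close> this is the ideal N Z[1/n]; in particular
  \<open>frac_ideal n 1\<close> is Z[1/n] itself.\<close>

definition frac_ideal :: "int \<Rightarrow> int \<Rightarrow> rat set" where
  "frac_ideal n N = {q. \<exists>k z. of_int n ^ k * q = of_int (N * z)}"

lemma frac_ideal_add:
  assumes "p \<in> frac_ideal n N" "q \<in> frac_ideal n N"
  shows "p + q \<in> frac_ideal n N"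
proof -
  obtain k y l z where p: "of_int n ^ k * p = of_int (N * y)" and q: "of_int n ^ l * q = of_int (N * z)"
    using assms by (auto simp: frac_ideal_def)
  have "of_int n ^ (k + l) * (p + q) =
      of_int n ^ l * (of_int n ^ k * p) + of_int n ^ k * (of_int n ^ l * q)"
    by (simp add: power_add algebra_simps)
  also have "\<dots> = of_int (N * (n ^ l * y + n ^ k * z))"
    unfolding p q by (simp add: algebra_simps)
  finally show ?thesis unfolding frac_ideal_def by blast
qed

lemma frac_ideal_uminus:
  assumes "p \<in> frac_ideal n N"
  shows "- p \<in> frac_ideal n N"
proof -
  obtain k z where "of_int n ^ k * p = of_int (N * z)" using assms by (auto simp: frac_ideal_def)
  then have "of_int n ^ k * - p = of_int (N * - z)" by simp
  then show ?thesis unfolding frac_ideal_def by blast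
qed

lemma frac_ideal_diff:
  "p \<in> frac_ideal n N \<Longrightarrow> q \<in> frac_ideal n N \<Longrightarrow> p - q \<in> frac_ideal n N"
  using frac_ideal_add[OF _ frac_ideal_uminus] by fastforce

text \<open>\<open>n\<close> is a unit of Z[1/n]. A negative \<open>j\<close> is paid for by
  \<open>nat (- j)\<close> further powers of \<open>n\<close> in the denominator.\<close>

lemma frac_ideal_powi:
  assumes n: "n \<noteq> 0" and p: "p \<in> frac_ideal n N"
  shows "of_int n powi j * p \<in> frac_ideal n N"
proof -
  obtain k z where k: "of_int n ^ k * p = of_int (N * z)" using p by (auto simp: frac_ideal_def)
  have "(of_int n :: rat) powi (int (k + nat (- j)) + j) = of_int n ^ (k + nat (- j)) * of_int n powi j"
    using n by (subst power_int_add) (simp_all only: power_int_of_nat of_int_eq_0_iff simp_thms)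
  then have "of_int n ^ (k + nat (- j)) * (of_int n powi j * p) = of_int n powi (int (k + nat (- j)) + j) * p"
    by (simp only: mult.assoc)
  also have "int (k + nat (- j)) + j = int (k + nat j)" by simp
  also have "of_int n powi int (k + nat j) * p = of_int n ^ nat j * (of_int n ^ k * p)"
    unfolding power_int_of_nat by (simp add: power_add)
  also have "\<dots> = of_int (N * (n ^ nat j * z))" unfolding k by simp
  finally show ?thesis unfolding frac_ideal_def by blast
qed

text \<open>Powers of \<open>n\<close> cancel modulo \<open>N\<close> by coprimality, so no new
  integers enter the ideal.\<close>

lemma of_int_frac_ideal_iff:
  assumes "coprime n N"
  shows "(of_int d :: rat) \<in> frac_ideal n N \<longleftrightarrow> N dvd d"
proof
  assume "(of_int d :: rat) \<in> frac_ideal n N"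
  then obtain k z where "(of_int n ^ k * of_int d :: rat) = of_int (N * z)" by (auto simp: frac_ideal_def)
  then have "n ^ k * d = N * z" by (simp only: of_int_eq_iff flip: of_int_power of_int_mult)
  then have "N dvd n ^ k * d" by simp
  then show "N dvd d" using assms by (simp add: coprime_dvd_mult_right_iff coprime_commute)
next
  assume "N dvd d"
  then obtain z where "d = N * z" ..
  then have "of_int n ^ 0 * (of_int d :: rat) = of_int (N * z)" by simp
  then show "(of_int d :: rat) \<in> frac_ideal n N" unfolding frac_ideal_def by blast
qed

text \<open>For \<open>N\<close> prime to \<open>n\<close> the inclusion of \<open>\<int>\<close> into \<open>\<int>[1/n]\<close> induces an isomorphism modulo \<open>N\<close>, so every
  residue class has an integer representative.\<close>

definition frac_res :: "int \<Rightarrow> int \<Rightarrow> rat \<Rightarrow> int" where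
  "frac_res n N q = (SOME y. 0 \<le> y \<and> y < N \<and> q - of_int y \<in> frac_ideal n N)"

lemma frac_res:
  assumes N: "N > 0" "coprime n N" and q: "q \<in> frac_ideal n 1"
  shows "0 \<le> frac_res n N q" "frac_res n N q < N" "q - of_int (frac_res n N q) \<in> frac_ideal n N"
proof -
  obtain k z where k: "of_int n ^ k * q = of_int z" using q by (auto simp: frac_ideal_def)
  have "gcd (n ^ k) N = 1" using N(2) by simp
  \<comment> \<open>\<open>u\<close> inverts \<open>n ^ k\<close> modulo \<open>N\<close>, so
    \<open>u * z\<close> represents the fraction z / n^k.\<close>
  then obtain u v where uv: "u * n ^ k + v * N = 1"
    using bezout_int[of "n ^ k" N] by metis
  define y where "y = (u * z) mod N"
  have y: "y = u * z - N * (u * z div N)"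
    unfolding y_def by (rule minus_mult_div_eq_mod[symmetric])
  have "of_int n ^ k * (q - of_int y) = of_int (z - n ^ k * y)"
    by (simp add: right_diff_distrib k)
  also have "z - n ^ k * y = (u * n ^ k + v * N) * z - n ^ k * y" by (simp add: uv)
  also have "\<dots> = N * (v * z + n ^ k * (u * z div N))"
    unfolding y by (simp add: algebra_simps)
  finally have "q - of_int y \<in> frac_ideal n N" unfolding frac_ideal_def by blast
  then have "\<exists>y. 0 \<le> y \<and> y < N \<and> q - of_int y \<in> frac_ideal n N"
    using N by (intro exI[of _ y]) (simp add: y_def)
  from someI_ex[OF this]
  show "0 \<le> frac_res n N q" "frac_res n N q < N" "q - of_int (frac_res n N q) \<in> frac_ideal n N"
    unfolding frac_res_def by blast+
qed

text \<open>Congruent arguments have the same defining predicate, so \<open>SOME\<close> returns the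
  same residue.\<close>

lemma frac_res_cong:
  assumes "p - q \<in> frac_ideal n N"
  shows "frac_res n N p = frac_res n N q"
proof -
  have "p - of_int y \<in> frac_ideal n N \<longleftrightarrow> q - of_int y \<in> frac_ideal n N" for y
    using frac_ideal_diff[OF _ assms, of "p - of_int y"] frac_ideal_add[OF _ assms, of "q - of_int y"]
    by (auto simp: algebra_simps)
  then show ?thesis unfolding frac_res_def by simp
qed

lemma frac_res_eq_imp:
  assumes "N > 0" "coprime n N" "p \<in> frac_ideal n 1" "q \<in> frac_ideal n 1"
    and "frac_res n N p = frac_res n N q"
  shows "p - q \<in> frac_ideal n N"
  using frac_ideal_diff[OF frac_res(3)[OF assms(1-3)] frac_res(3)[OF assms(1,2,4)]] assms(5) by simp

text \<open>The two candidate residues differ by an integer in the ideal, hence by a multiple of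
  \<open>N\<close>.\<close>

lemma frac_res_add_of_int:
  assumes N: "N > 0" "coprime n N" and q: "q \<in> frac_ideal n 1"
  shows "frac_res n N (q + of_int b) = (frac_res n N q + b) mod N"
proof -
  let ?y = "frac_res n N q" and ?y' = "frac_res n N (q + of_int b)"
  have "of_int b \<in> frac_ideal n 1" by (simp add: of_int_frac_ideal_iff)
  note q' = frac_ideal_add[OF q this]
  have "of_int (?y + b - ?y') \<in> frac_ideal n N"
    using frac_ideal_diff[OF frac_res(3)[OF N q'] frac_res(3)[OF N q]] by (simp add: algebra_simps)
  then have "N dvd ?y + b - ?y'" by (simp only: of_int_frac_ideal_iff[OF N(2)])
  then have "(?y + b) mod N = ?y' mod N" by (simp add: mod_eq_dvd_iff)
  then show ?thesis using frac_res(1,2)[OF N q'] by simp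
qed

text \<open>On the circle of length \<open>2 L + 1\<close> cut into two arcs, a step shorter than either arc that does
  not change the arc does not leave it.\<close>

lemma arc_step:
  fixes w L b :: int
  assumes "0 \<le> w" "w < 2 * L + 1" "\<bar>b\<bar> < L" "(w + b) mod (2 * L + 1) < L \<longleftrightarrow> w < L"
  shows "0 \<le> w + b" "w + b < 2 * L + 1" "w + b < L \<longleftrightarrow> w < L"
proof -
  \<comment> \<open>Wrapping around in either direction ends in the other arc, so the first and
    third cases are contradictory.\<close>
  consider "w + b < 0" | "0 \<le> w + b" "w + b < 2 * L + 1" | "2 * L + 1 \<le> w + b" by linarith
  then have "0 \<le> w + b \<and> w + b < 2 * L + 1 \<and> (w + b < L \<longleftrightarrow> w < L)"
  proof cases
    case 1
    then have "(w + b) mod (2 * L + 1) = w + b + (2 * L + 1)"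
      using mod_pos_pos_trivial[of "w + b + (2 * L + 1)" "2 * L + 1"] assms
      by (simp only: mod_add_self2)
    then show ?thesis using 1 assms by linarith
  next
    case 2
    then show ?thesis using assms by simp
  next
    case 3
    then have "(w + b) mod (2 * L + 1) = w + b - (2 * L + 1)"
      using mod_add_self2[of "w + b - (2 * L + 1)" "2 * L + 1"]
        mod_pos_pos_trivial[of "w + b - (2 * L + 1)" "2 * L + 1"] assms
      by (simp only: diff_add_cancel)
    then show ?thesis using 3 assms by linarith
  qed
  then show "0 \<le> w + b" "w + b < 2 * L + 1" "w + b < L \<longleftrightarrow> w < L" by auto
qed

section \<open>The shift action and a criterion for periodicity\<close>

context group
begin

lemma shift_mult:
  assumes "g \<in> carrier G" "h \<in> carrier G"
  shows "shift G g (shift G h x) = shift G (g \<otimes> h) x"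
  using assms by (auto simp: shift_def inv_mult_group m_assoc intro!: restrict_ext)

lemma shift_one: "x \<in> extensional (carrier G) \<Longrightarrow> shift G \<one> x = x"
  by (auto simp: shift_def extensional_def)

lemma subgroup_stabilizer_shift:
  assumes x: "x \<in> extensional (carrier G)"
  shows "subgroup (stabilizer G (shift G) x) G"
proof
  fix g assume "g \<in> stabilizer G (shift G) x"
  then have g: "g \<in> carrier G" "shift G g x = x" by (auto simp: stabilizer_def)
  then have "shift G (inv g) x = shift G (inv g) (shift G g x)" by simp
  also have "\<dots> = x" using g(1) by (simp add: shift_mult shift_one x)
  finally show "inv g \<in> stabilizer G (shift G) x" using g by (simp add: stabilizer_def)
next
  fix g h assume "g \<in> stabilizer G (shift G) x" "h \<in> stabilizer G (shift G) x"
  then show "g \<otimes> h \<in> stabilizer G (shift G) x"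
    by (auto simp: stabilizer_def simp flip: shift_mult)
qed (auto simp: stabilizer_def shift_one x)

text \<open>Each fibre of \<open>f\<close> lies in one right coset of the stabilizer, so there are
  at most as many cosets as values of \<open>f\<close>.\<close>

lemma periodicI:
  assumes x: "x \<in> extensional (carrier G)" and fin: "finite (f ` carrier G)"
    and stab: "\<And>g h. \<lbrakk>g \<in> carrier G; h \<in> carrier G; f g = f h\<rbrakk> \<Longrightarrow> shift G (h \<otimes> inv g) x = x"
  shows "periodic G x"
proof -
  let ?H = "stabilizer G (shift G) x"
  have coset: "?H #> g = ?H #> h" if "g \<in> carrier G" "h \<in> carrier G" "f g = f h" for g h
  proof -
    have "h \<otimes> inv g \<in> ?H" using stab[OF that] that by (simp add: stabilizer_def)
    moreover have "h \<otimes> inv g \<otimes> g = h" using that by (simp add: m_assoc)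
    ultimately have "h \<in> ?H #> g" by (force simp: r_coset_def)
    then show ?thesis using that subgroup_stabilizer_shift[OF x] by (intro repr_independence)
  qed
  have "rcosets ?H \<subseteq> (\<lambda>v. ?H #> inv_into (carrier G) f v) ` f ` carrier G"
  proof
    fix C assume "C \<in> rcosets ?H"
    then obtain g where g: "g \<in> carrier G" "C = ?H #> g" by (auto simp: RCOSETS_def)
    have "C = ?H #> inv_into (carrier G) f (f g)"
      using g coset[of g "inv_into (carrier G) f (f g)"]
      by (simp add: f_inv_into_f inv_into_into)
    then show "C \<in> (\<lambda>v. ?H #> inv_into (carrier G) f v) ` f ` carrier G" using g by blast
  qed
  then show ?thesis unfolding periodic_def using fin by (meson finite_imageI finite_subset)
qed

end

context bs_model
begin

text \<open>The group is cut into horizontal strips \<open>s l \<le> T < (s + 1) l\<close> of alternating colours. After rescaling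
  \<open>Q\<close> by the power of \<open>n\<close> belonging to the strip, short steps inside a strip change it by bounded
  integers, so that colouring two arcs of \<open>\<int>/N\<close> separates the strip into bounded pieces.\<close>

definition strip_pos :: "nat \<Rightarrow> int \<Rightarrow> 'a \<Rightarrow> rat" where
  "strip_pos P l g = nr powi (int P - l * (T g div l)) * Q g"

definition strip_colouring :: "nat \<Rightarrow> int \<Rightarrow> int \<Rightarrow> 'a \<Rightarrow> nat" where
  "strip_colouring P l L = (\<lambda>g\<in>carrier G. 1 + (if even (T g div l) then 0 else 2) +
     (if frac_res n (2 * L + 1) (strip_pos P l g) < L then 0 else 1))"

lemma Q_frac_ideal: "g \<in> carrier G \<Longrightarrow> Q g \<in> frac_ideal n 1"
  using Q_denominator[of g] by (auto simp: frac_ideal_def elim!: Ints_cases)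

lemma strip_pos_frac_ideal: "g \<in> carrier G \<Longrightarrow> strip_pos P l g \<in> frac_ideal n 1"
  unfolding strip_pos_def by (intro frac_ideal_powi Q_frac_ideal n_nonzero)

lemma strip_colouring_eqD:
  assumes "g \<in> carrier G" "h \<in> carrier G" "strip_colouring P l L g = strip_colouring P l L h"
  shows "even (T g div l) \<longleftrightarrow> even (T h div l)"
    "frac_res n (2 * L + 1) (strip_pos P l g) < L \<longleftrightarrow> frac_res n (2 * L + 1) (strip_pos P l h) < L"
  using assms by (auto simp: strip_colouring_def split: if_splits)

text \<open>Translation by \<open>h\<close> moves the strip index by an even number, and the
  rescaling exponent compensates the factor \<open>n powi - T h\<close>. The remaining change of
  \<open>strip_pos\<close> is, up to sign, a power of \<open>n\<close> times \<open>Q h\<close>,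
  which lies in the ideal.\<close>

lemma strip_colouring_invariant:
  assumes l: "l > 0" and h: "h \<in> carrier G" "2 * l dvd T h" "Q h \<in> frac_ideal n (2 * L + 1)"
  shows "shift G h (strip_colouring P l L) = strip_colouring P l L"
proof -
  let ?x = "strip_colouring P l L"
  have "?x (inv h \<otimes> g) = ?x g" if g: "g \<in> carrier G" for g
  proof -
    obtain c where c: "T h = 2 * l * c" using h by blast
    have T: "T (inv h \<otimes> g) = T g + (- 2 * c) * l" using h g by (simp add: T_inv_mult c)
    have div: "T (inv h \<otimes> g) div l = - 2 * c + T g div l" unfolding T using l by (subst div_mult_self1) auto
    have "strip_pos P l (inv h \<otimes> g) - strip_pos P l g =
        nr powi (int P - l * (T (inv h \<otimes> g) div l)) * (nr powi - T h * - Q h)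
        + (nr powi (int P - l * (T (inv h \<otimes> g) div l)) * nr powi - T h - nr powi (int P - l * (T g div l))) * Q g"
      unfolding strip_pos_def Q_inv_mult[OF h(1) g] by (simp add: algebra_simps)
    also have "nr powi (int P - l * (T (inv h \<otimes> g) div l)) * nr powi - T h = nr powi (int P - l * (T g div l))"
      unfolding div powi_mult_powi by (simp add: c algebra_simps)
    finally have "strip_pos P l (inv h \<otimes> g) - strip_pos P l g \<in> frac_ideal n (2 * L + 1)"
      using h by (simp add: frac_ideal_powi frac_ideal_uminus n_nonzero)
    from frac_res_cong[OF this] show ?thesis
      using h g by (simp add: strip_colouring_def div)
  qed
  then show ?thesis
    by (auto simp: shift_def strip_colouring_def intro!: restrict_ext)
qed

lemma periodic_strip_colouring:
  assumes l: "l > 0" and L: "L > 0" "coprime n (2 * L + 1)"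
  shows "periodic G (strip_colouring P l L)"
proof (rule periodicI)
  let ?N = "2 * L + 1"
  \<comment> \<open>Up to sign this is \<open>Q (inv g)\<close>: then
    \<open>Q (h \<otimes> inv g)\<close> equals \<open>nr powi T h * (?q h - ?q g)\<close>, so equal
    residues put it in the ideal.\<close>
  let ?q = "\<lambda>g. nr powi - T g * Q g"
  let ?f = "\<lambda>g. (frac_res n ?N (?q g), T g mod (2 * l))"
  have q: "?q g \<in> frac_ideal n 1" if "g \<in> carrier G" for g
    using that by (intro frac_ideal_powi Q_frac_ideal n_nonzero)
  show "strip_colouring P l L \<in> extensional (carrier G)" by (simp add: strip_colouring_def)
  have "?f ` carrier G \<subseteq> {0..?N} \<times> {0..2 * l}"
  proof (rule image_subsetI)
    fix g assume "g \<in> carrier G"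
    note frac_res(1,2)[of ?N n, OF _ L(2) q[OF this]]
    then show "?f g \<in> {0..?N} \<times> {0..2 * l}" using l L(1) by (simp add: less_imp_le)
  qed
  then show "finite (?f ` carrier G)" by (rule finite_subset) simp
  fix g h assume gh: "g \<in> carrier G" "h \<in> carrier G" and eq: "?f g = ?f h"
  show "shift G (h \<otimes> inv g) (strip_colouring P l L) = strip_colouring P l L"
  proof (rule strip_colouring_invariant[OF l])
    show "h \<otimes> inv g \<in> carrier G" using gh by simp
    show "2 * l dvd T (h \<otimes> inv g)" using eq gh by (simp add: T_mult T_inv mod_eq_dvd_iff[symmetric])
    have "?q h - ?q g \<in> frac_ideal n ?N"
      using eq L(1) by (intro frac_res_eq_imp L(2) q gh) auto
    then have "nr powi T h * (?q h - ?q g) \<in> frac_ideal n ?N"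
      by (intro frac_ideal_powi n_nonzero)
    also have "nr powi T h * (?q h - ?q g) = Q (h \<otimes> inv g)"
      using gh n_nonzero by (simp add: Q_mult Q_inv right_diff_distrib power_int_minus)
    finally show "Q (h \<otimes> inv g) \<in> frac_ideal n ?N" .
  qed
qed

text \<open>Since \<open>T\<close> changes by less than \<open>l\<close>, the strip index changes by
  at most one, and equal parity excludes a change. The displacement of \<open>strip_pos\<close> is
  n^e times \<open>nr ^ P * Q (inv g \<otimes> h)\<close> with \<open>e = T g mod l\<close>
  nonnegative; thus \<open>P\<close> only has to clear the denominators of steps in
  \<open>F\<close>.\<close>

lemma strip_step:
  assumes l: "l > 0" and B: "\<And>g. g \<in> F \<Longrightarrow> \<bar>T g\<bar> < l" "\<And>g. g \<in> F \<Longrightarrow> nr ^ P * Q g \<in> \<int>"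
      "\<And>g. g \<in> F \<Longrightarrow> \<bar>nr ^ P * Q g\<bar> \<le> of_int B"
    and gh: "g \<in> carrier G" "h \<in> carrier G" "inv g \<otimes> h \<in> F"
    and same: "even (T g div l) \<longleftrightarrow> even (T h div l)"
  shows "T h div l = T g div l"
    "\<exists>b. strip_pos P l h = strip_pos P l g + of_int b \<and> \<bar>b\<bar> \<le> \<bar>n\<bar> ^ nat l * B"
proof -
  let ?k = "inv g \<otimes> h"
  have k: "?k \<in> carrier G" "h = g \<otimes> ?k" using gh by (simp_all add: m_assoc[symmetric])
  have "\<bar>T h - T g\<bar> < l" using B(1)[OF gh(3)] gh by (simp add: T_inv_mult)
  then have "T h < T g + l" "T g < T h + l" by linarith+
  then have "T h div l \<le> (T g + l) div l" "T g div l \<le> (T h + l) div l"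
    using l by (intro zdiv_mono1; linarith)+
  then have "T h div l \<le> T g div l + 1" "T g div l \<le> T h div l + 1" using l by simp_all
  then show div: "T h div l = T g div l"
  proof -
    have "a = b" if "a \<le> b + 1" "b \<le> a + 1" "even b \<longleftrightarrow> even a" for a b :: int
      using that by presburger
    from this[OF _ _ same] show ?thesis
      using \<open>T h div l \<le> T g div l + 1\<close> \<open>T g div l \<le> T h div l + 1\<close> by blast
  qed
  obtain z where z: "nr ^ P * Q ?k = of_int z" using B(2)[OF gh(3)] by (auto simp: Ints_def)
  have zB: "\<bar>z\<bar> \<le> B" using B(3)[OF gh(3)] unfolding z by (simp flip: of_int_abs)
  define e where "e = nat (T g mod l)"
  have e: "int e = T g mod l" "e \<le> nat l" using l by (auto simp: e_def nat_mono less_imp_le)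
  have "strip_pos P l h = strip_pos P l g + nr powi (int P - l * (T g div l)) * (nr powi T g * Q ?k)"
    using Q_mult[OF gh(1) k(1)] k(2) unfolding strip_pos_def div by (simp add: distrib_left)
  also have "nr powi (int P - l * (T g div l)) * (nr powi T g * Q ?k) = nr powi (int P - l * (T g div l) + T g) * Q ?k"
    by (simp add: mult.assoc flip: powi_mult_powi)
  also have "int P - l * (T g div l) + T g = int e + int P"
    using e(1) by (simp add: minus_mult_div_eq_mod[symmetric])
  also have "nr powi (int e + int P) * Q ?k = nr ^ e * (nr ^ P * Q ?k)"
    by (simp add: power_int_add)
  also have "\<dots> = of_int (n ^ e * z)" unfolding z by simp
  finally have "strip_pos P l h = strip_pos P l g + of_int (n ^ e * z)" .
  moreover have "\<bar>n ^ e * z\<bar> \<le> \<bar>n\<bar> ^ nat l * B"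
    unfolding abs_mult power_abs using e(2) n_nonzero zB
    by (intro mult_mono power_increasing) auto
  ultimately show "\<exists>b. strip_pos P l h = strip_pos P l g + of_int b \<and> \<bar>b\<bar> \<le> \<bar>n\<bar> ^ nat l * B" by blast
qed

text \<open>Along a path the displacements add up to \<open>b\<close>. By \<open>arc_step\<close> no
  step wraps around the circle, so the residue of \<open>g0\<close> plus \<open>b\<close> stays
  between 0 and \<open>2 * L\<close> as an integer, not merely modulo
  \<open>2 * L + 1\<close>.\<close>

lemma strip_component:
  assumes l: "l > 0" and F: "\<And>g. g \<in> carrier G \<Longrightarrow> word_norm G S g \<le> r \<Longrightarrow> g \<in> F"
    and B: "\<And>g. g \<in> F \<Longrightarrow> \<bar>T g\<bar> < l" "\<And>g. g \<in> F \<Longrightarrow> nr ^ P * Q g \<in> \<int>"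
      "\<And>g. g \<in> F \<Longrightarrow> \<bar>nr ^ P * Q g\<bar> \<le> of_int B"
    and L: "\<bar>n\<bar> ^ nat l * B < L" "coprime n (2 * L + 1)" "L > 0"
    and g0: "g0 \<in> carrier G"
    and path: "(g0, g) \<in> (colour_edges G S r (strip_colouring P l L) c)\<^sup>*"
  shows "g \<in> carrier G \<and> T g div l = T g0 div l \<and>
    (\<exists>b. strip_pos P l g = strip_pos P l g0 + of_int b \<and>
      0 \<le> frac_res n (2 * L + 1) (strip_pos P l g0) + b \<and>
      frac_res n (2 * L + 1) (strip_pos P l g0) + b < 2 * L + 1)"
  using path
proof (induction rule: rtrancl_induct)
  case base
  show ?case
    using g0 frac_res(1,2)[OF _ L(2) strip_pos_frac_ideal[OF g0]] L(3)
    by (intro conjI exI[of _ 0]) auto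
next
  case (step g h)
  let ?N = "2 * L + 1"
  let ?y = "frac_res n ?N (strip_pos P l g0)"
  obtain b where b: "strip_pos P l g = strip_pos P l g0 + of_int b" "0 \<le> ?y + b" "?y + b < ?N"
    and g: "g \<in> carrier G" "T g div l = T g0 div l"
    using step.IH by blast
  have h: "h \<in> carrier G" and k: "inv g \<otimes> h \<in> F"
    and eq: "strip_colouring P l L g = strip_colouring P l L h"
    using step.hyps(2) F g by (auto simp: colour_edges_def colour_class_def)
  note same = strip_colouring_eqD[OF g(1) h eq]
  note st = strip_step[of l F P B g h, OF l B g(1) h k same(1)]
  obtain d where d: "strip_pos P l h = strip_pos P l g + of_int d" "\<bar>d\<bar> \<le> \<bar>n\<bar> ^ nat l * B"
    using st(2) by blast
  have N: "?N > 0" using L(3) by simp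
  have res: "frac_res n ?N (strip_pos P l g0 + of_int b') = (?y + b') mod ?N" for b'
    by (rule frac_res_add_of_int[OF N L(2) strip_pos_frac_ideal[OF g0]])
  have h_eq: "strip_pos P l h = strip_pos P l g0 + of_int (b + d)" using d b by simp
  have "frac_res n ?N (strip_pos P l g) = ?y + b" unfolding b(1) res using b by simp
  moreover have "frac_res n ?N (strip_pos P l h) = (?y + b + d) mod ?N"
    unfolding h_eq res by (simp add: add.assoc)
  ultimately have "(?y + b + d) mod ?N < L \<longleftrightarrow> ?y + b < L" using same(2) by simp
  from arc_step[OF b(2,3) _ this] d(2) L(1)
  have "0 \<le> ?y + (b + d)" "?y + (b + d) < ?N" by (auto simp: add.assoc)
  then show ?case using h st(1) g(2) h_eq by (intro conjI exI[of _ "b + d"]) auto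
qed

lemma four_colouring:
  assumes S: "finite_symmetric_generating_set G S"
  shows "\<exists>m. \<exists>x\<in>bounded_configurations G S 4 r m. periodic G x"
proof -
  define F where "F = {g \<in> carrier G. word_norm G S g \<le> r}"
  have fin: "finite F" unfolding F_def by (rule finite_word_norm_ball[OF S])
  have bdd: "\<exists>M. \<forall>g\<in>F. f g \<le> M" for f :: "'a \<Rightarrow> int"
    using fin by (intro exI[of _ "Max (f ` F)"]) auto
  obtain k where k: "\<And>g. g \<in> F \<Longrightarrow> nr ^ k g * Q g \<in> \<int>"
    using Q_denominator by (metis (no_types, lifting) F_def mem_Collect_eq)
  \<comment> \<open>The sum dominates every \<open>k g\<close> and so clears all denominators in the
    ball.\<close>
  define P where "P = (\<Sum>g\<in>F. k g)"
  have P: "nr ^ P * Q g \<in> \<int>" if "g \<in> F" for g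
  proof -
    have "k g \<le> P" unfolding P_def using fin that by (intro member_le_sum) auto
    then have "nr ^ P * Q g = of_int (n ^ (P - k g)) * (nr ^ k g * Q g)"
      by (simp add: mult.assoc[symmetric] power_add[symmetric])
    also have "\<dots> \<in> \<int>" by (rule Ints_mult[OF Ints_of_int k[OF that]])
    finally show ?thesis .
  qed
  obtain V where V: "\<And>g. g \<in> F \<Longrightarrow> \<bar>T g\<bar> \<le> V" using bdd[of "\<lambda>g. \<bar>T g\<bar>"] by blast
  obtain B where B: "\<And>g. g \<in> F \<Longrightarrow> \<lceil>\<bar>nr ^ P * Q g\<bar>\<rceil> \<le> B"
    using bdd[of "\<lambda>g. \<lceil>\<bar>nr ^ P * Q g\<bar>\<rceil>"] by blast
  define l where "l = \<bar>V\<bar> + 1"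
  define C where "C = \<bar>n\<bar> ^ nat l * B"
  \<comment> \<open>Larger than the displacement bound \<open>C\<close>, and a multiple of
    \<open>n\<close> so that \<open>2 * L + 1\<close> is prime to \<open>n\<close>.\<close>
  define L where "L = \<bar>n\<bar> * (\<bar>C\<bar> + 1)"
  have l: "l > 0" by (simp add: l_def)
  have "\<bar>C\<bar> + 1 \<le> L"
    using mult_right_mono[of 1 "\<bar>n\<bar>" "\<bar>C\<bar> + 1"] n_nonzero by (simp add: L_def)
  then have L: "C < L" "L > 0" by linarith+
  have coprime: "coprime n (2 * L + 1)"
  proof (rule coprimeI)
    fix d assume d: "d dvd n" "d dvd 2 * L + 1"
    have "d dvd 2 * L" using d(1) by (simp add: L_def)
    then show "is_unit d" using d(2) by (simp add: dvd_add_right_iff)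
  qed
  let ?x = "strip_colouring P l L" and ?N = "2 * L + 1"
  have "?x \<in> configurations G 4" by (auto simp: configurations_def strip_colouring_def)
  moreover have "finite ((colour_edges G S r ?x c)\<^sup>* `` {g0}) \<and>
      card ((colour_edges G S r ?x c)\<^sup>* `` {g0}) \<le> nat l * nat (2 * ?N + 1)"
    if "g0 \<in> colour_class G ?x c" for c g0
  proof -
    have g0: "g0 \<in> carrier G" using that by (simp add: colour_class_def)
    let ?A = "(colour_edges G S r ?x c)\<^sup>* `` {g0}"
    let ?s = "T g0 div l"
    \<comment> \<open>Displacements within the component are integers, so the floor loses nothing.
      Height and displacement determine the element, and \<open>?box\<close> allows \<open>l\<close>
      heights and displacements up to \<open>?N\<close> in absolute value.\<close>
    let ?f = "\<lambda>g. (T g, \<lfloor>strip_pos P l g - strip_pos P l g0\<rfloor>)"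
    let ?box = "{l * ?s..<l * ?s + l} \<times> {- ?N..?N}"
    have comp: "g \<in> carrier G \<and> T g div l = ?s \<and> (\<exists>b. strip_pos P l g = strip_pos P l g0 + of_int b \<and>
        0 \<le> frac_res n ?N (strip_pos P l g0) + b \<and> frac_res n ?N (strip_pos P l g0) + b < ?N)"
      if "g \<in> ?A" for g
    proof (rule strip_component[of l S r F P B, OF l _ _ P])
      show "g \<in> F" if "g \<in> carrier G" "word_norm G S g \<le> r" for g using that by (simp add: F_def)
      show "\<bar>T g\<bar> < l" if "g \<in> F" for g using V[OF that] by (simp add: l_def)
      show "\<bar>nr ^ P * Q g\<bar> \<le> of_int B" if "g \<in> F" for g using B[OF that] by (simp add: ceiling_le_iff)
    qed (use that L coprime g0 in \<open>auto simp: C_def\<close>)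
    have "inj_on ?f ?A"
    proof (rule inj_onI)
      fix g h assume gh: "g \<in> ?A" "h \<in> ?A" and eq: "?f g = ?f h"
      obtain b b' where "strip_pos P l g = strip_pos P l g0 + of_int b" "strip_pos P l h = strip_pos P l g0 + of_int b'"
        using comp[OF gh(1)] comp[OF gh(2)] by blast
      then have "strip_pos P l g = strip_pos P l h" using eq by simp
      then have "Q g = Q h" using eq by (simp add: strip_pos_def)
      then show "g = h" using comp gh eq by (intro QT_inj) auto
    qed
    moreover have sub: "?f ` ?A \<subseteq> ?box"
    proof (rule image_subsetI)
      fix g assume "g \<in> ?A"
      note c = comp[OF this]
      then obtain b where b: "strip_pos P l g = strip_pos P l g0 + of_int b"
        "0 \<le> frac_res n ?N (strip_pos P l g0) + b" "frac_res n ?N (strip_pos P l g0) + b < ?N" by blast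
      have "T g = l * ?s + T g mod l" using c by (metis mult_div_mod_eq)
      moreover have "0 \<le> T g mod l" "T g mod l < l" using l by simp_all
      ultimately have "T g \<in> {l * ?s..<l * ?s + l}" by (metis add.commute add_increasing add_strict_left_mono atLeastLessThan_iff order_refl)
      moreover have "b \<in> {- ?N..?N}"
        using b(2,3) frac_res(1,2)[OF _ coprime strip_pos_frac_ideal[OF g0, of P l]] L(2) by simp
      ultimately show "?f g \<in> ?box" using b(1) by simp
    qed
    moreover have "card ?box = nat l * nat (2 * ?N + 1)" by (simp add: card_cartesian_product)
    ultimately show ?thesis
      using inj_on_finite[of ?f ?A ?box] card_inj_on_le[of ?f ?A ?box] by simp
  qed
  ultimately have "?x \<in> bounded_configurations G S 4 r (nat l * nat (2 * ?N + 1))"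
    unfolding bounded_configurations_def by blast
  then show ?thesis using periodic_strip_colouring[OF l L(2) coprime] by blast
qed

end

section \<open>The two bounds combined\<close>

theorem corollary9p10:
  fixes n :: int and S :: "bs_gen word set set"
  assumes "n \<noteq> 0"
    and "finite_symmetric_generating_set (BS1 n) S"
  shows "pdim (BS1 n) S \<in> {2, 3}"
proof -
  interpret bs_model "BS1 n" n "fst \<circ> bs_val n" "snd \<circ> bs_val n"
    by (rule bs_model_BS1[OF assms(1)])
  let ?D = "{enat d | d. \<forall>r. \<exists>m. \<exists>x\<in>bounded_configurations (BS1 n) S (d + 1) r m. periodic (BS1 n) x}"
  have "enat 3 \<in> ?D" using four_colouring[OF assms(2)] by simp
  then have "Inf ?D \<le> 3" by (metis (no_types, lifting) Inf_lower numeral_eq_enat)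
  \<comment> \<open>An admissible \<open>d\<close> provides configurations in \<open>d + 1\<close>
    colours at every scale; at most two colours would contradict
    \<open>no_two_colouring\<close>.\<close>
  moreover have "2 \<le> Inf ?D"
  proof (rule Inf_greatest)
    fix e assume "e \<in> ?D"
    then obtain d where d: "e = enat d" and ex: "\<And>r. \<exists>m. bounded_configurations (BS1 n) S (d + 1) r m \<noteq> {}"
      by blast
    have "\<not> d + 1 \<le> 2"
      using no_two_colouring[OF assms(2)] ex bounded_configurations_mono_colours[of "d + 1" 2 "BS1 n" S]
      by blast
    then show "2 \<le> e" by (simp add: d numeral_eq_enat)
  qed
  ultimately obtain k where k: "pdim (BS1 n) S = enat k" "k \<le> 3" "2 \<le> k"
    unfolding pdim_def by (cases "Inf ?D") (auto simp: numeral_eq_enat)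
  then have "k = 2 \<or> k = 3" by linarith
  then show ?thesis using k(1) by (auto simp: numeral_eq_enat)
qed

end
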